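(* Consider the wave map equation on $\mathbf{R}^{1+1}$. If the target manifold is the unit circle $S^1$ in the complex plane, the initial position is $f\equiv1$, and the initial velocity $ig$ is smooth (with $g:\mathbf{R}\to\mathbf{R}$), then the solution asymptotically approaches a free solution in $\dot H^1(\mathbf{R})$ if and only if the limits $G_\pm=\lim_{x\to\pm\infty}G(x)$ exist, where $G$ is a primitive of $g$. In particular, there is data in $\dot H^1\times L^2$ which does not scatter.
   Context: $\mathbf{R}^{1+1}$ has coordinates $(x,t)$. The wave map equation into the sphere, here $S^1\subset\mathbf{C}\cong\mathbf{R}^2$, is $\phi_{uv}=-\phi\,(\phi_u\cdot\phi_v)$ with $u=x+t$, $v=x-t$, where $\cdot$ is the Euclidean inner product on $\mathbf{R}^2$, together with prescribed initial position and velocity $(\phi,\phi_t)|_{t=0}=(f,ig)$. "The solution $\phi$ asymptotically approaches a free solution in $\dot H^1(\mathbf{R})$" means that there is a (complex valued) solution $\psi(x,t)=f_+(x+t)+f_-(x-t)$ of the free wave equation with $\|\nabla_{x,t}(\phi-\psi)(\cdot,t)\|_{L^2_x(\mathbf{R})}\to0$ as $t\to+\infty$. Data "scatters" if its solution asymptotically approaches a free solution in this sense.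
   Formalization: In the direction "the limits exist implies the solution approaches a free solution", g is also assumed square integrable (data in Ḣ¹×L²); without this it fails, e.g. for G = arctan x + sin(x⁴)/(1+x²). The other direction holds for every smooth g. *)

theory Defs
  imports "HOL-Analysis.Analysis"
begin

definition smooth :: "(real \<Rightarrow> real) \<Rightarrow> bool" where
  "smooth g \<longleftrightarrow> (\<forall>n x. (deriv ^^ n) g differentiable (at x))"

definition L2 :: "(real \<Rightarrow> complex) \<Rightarrow> bool" where
  "L2 f \<longleftrightarrow> f \<in> borel_measurable lborel \<and> integrable lborel (\<lambda>x. (norm (f x))\<^sup>2)"

(* f is locally absolutely continuous (that is, W^{1,1}_loc) and f' is a version of its derivative. *)
definition has_ac_derivative :: "(real \<Rightarrow> complex) \<Rightarrow> (real \<Rightarrow> complex) \<Rightarrow> bool" where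
  "has_ac_derivative f f' \<longleftrightarrow>
     (\<forall>a b. a \<le> b \<longrightarrow>
        set_integrable lborel {a..b} f' \<and> f b - f a = (LINT y:{a..b}|lborel. f' y))"

definition energy_data :: "(real \<Rightarrow> complex) \<Rightarrow> (real \<Rightarrow> complex) \<Rightarrow> bool" where
  "energy_data f h \<longleftrightarrow> (\<exists>f'. has_ac_derivative f f' \<and> L2 f') \<and> L2 h"

text \<open>Functions on space-time take the arguments in the order \<open>x\<close>, \<open>t\<close>.\<close>

definition Dx :: "(real \<Rightarrow> real \<Rightarrow> complex) \<Rightarrow> real \<Rightarrow> real \<Rightarrow> complex" where
  "Dx \<phi> x t = vector_derivative (\<lambda>y. \<phi> y t) (at x)"

definition Dt :: "(real \<Rightarrow> real \<Rightarrow> complex) \<Rightarrow> real \<Rightarrow> real \<Rightarrow> complex" where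
  "Dt \<phi> x t = vector_derivative (\<lambda>s. \<phi> x s) (at t)"

text \<open>For the null coordinates \<open>u = x + t\<close>, \<open>v = x - t\<close> one has \<open>x = (u + v) / 2\<close> and
  \<open>t = (u - v) / 2\<close>, which gives the chain-rule factors one half.\<close>

definition Du :: "(real \<Rightarrow> real \<Rightarrow> complex) \<Rightarrow> real \<Rightarrow> real \<Rightarrow> complex" where
  "Du \<phi> x t = (Dx \<phi> x t + Dt \<phi> x t) / 2"

definition Dv :: "(real \<Rightarrow> real \<Rightarrow> complex) \<Rightarrow> real \<Rightarrow> real \<Rightarrow> complex" where
  "Dv \<phi> x t = (Dx \<phi> x t - Dt \<phi> x t) / 2"

definition C1_spacetime :: "(real \<Rightarrow> real \<Rightarrow> complex) \<Rightarrow> bool" where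
  "C1_spacetime \<phi> \<longleftrightarrow>
     (\<forall>x t. (\<lambda>y. \<phi> y t) differentiable (at x) \<and> (\<lambda>s. \<phi> x s) differentiable (at t)) \<and>
     continuous_on UNIV (\<lambda>(x, t). Dx \<phi> x t) \<and> continuous_on UNIV (\<lambda>(x, t). Dt \<phi> x t)"

definition C2_spacetime :: "(real \<Rightarrow> real \<Rightarrow> complex) \<Rightarrow> bool" where
  "C2_spacetime \<phi> \<longleftrightarrow> C1_spacetime \<phi> \<and> C1_spacetime (Dx \<phi>) \<and> C1_spacetime (Dt \<phi>)"

text \<open>Global classical solutions of the Cauchy problem for wave maps into the unit circle, with
  initial position \<open>f\<close> and initial velocity \<open>h\<close>. The inner product on \<^typ>\<open>complex\<close> is the
  Euclidean one of the plane.\<close>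

definition circle_wave_map ::
    "(real \<Rightarrow> complex) \<Rightarrow> (real \<Rightarrow> complex) \<Rightarrow> (real \<Rightarrow> real \<Rightarrow> complex) \<Rightarrow> bool" where
  "circle_wave_map f h \<phi> \<longleftrightarrow>
     C2_spacetime \<phi> \<and>
     (\<forall>x t. \<phi> x t \<in> sphere 0 1) \<and>
     (\<forall>x t. Du (Dv \<phi>) x t = - ((Du \<phi> x t \<bullet> Dv \<phi> x t) *\<^sub>R \<phi> x t)) \<and>
     (\<forall>x. \<phi> x 0 = f x) \<and>
     (\<forall>x. Dt \<phi> x 0 = h x)"

text \<open>The free wave is \<open>\<psi> x t = fp (x + t) + fm (x - t)\<close>, so that its \<open>x\<close>- and \<open>t\<close>-derivatives
  are \<open>fp' (x + t) + fm' (x - t)\<close> and \<open>fp' (x + t) - fm' (x - t)\<close>. The profiles are only required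
  to be locally absolutely continuous. The quantity tending to zero is the square of
  the \<open>L\<^sup>2\<close> norm of the space-time gradient of \<open>\<phi> - \<psi>\<close>, taken in the extended nonnegative reals
  so that an infinite norm is not read as zero.\<close>

definition approaches_free_wave :: "(real \<Rightarrow> real \<Rightarrow> complex) \<Rightarrow> bool" where
  "approaches_free_wave \<phi> \<longleftrightarrow>
     (\<exists>fp fm fp' fm'. has_ac_derivative fp fp' \<and> has_ac_derivative fm fm' \<and>
        ((\<lambda>t. \<integral>\<^sup>+ x. ennreal
               ((norm (Dx \<phi> x t - (fp' (x + t) + fm' (x - t))))\<^sup>2 +
                (norm (Dt \<phi> x t - (fp' (x + t) - fm' (x - t))))\<^sup>2) \<partial>lborel)
          \<longlongrightarrow> 0) at_top)"

end

theory Submission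
  imports Defs "HOL-Probability.Sinc_Integral"
begin

text \<open>For a circle-valued wave map \<open>\<phi>\<close> both \<open>\<phi>\<^sub>u\<close> and \<open>\<phi>\<^sub>v\<close> are tangential, so the equation makes
  \<open>cnj \<phi> * \<phi>\<^sub>v\<close> constant along the \<open>u\<close>-lines. This gives \<open>\<phi>\<^sub>v = - i g(v) \<phi> / 2\<close>, whose solution is
  \<open>\<phi> = exp (i (G(u) - G(v)) / 2)\<close>.

  By the parallelogram law and translation, the error of a free wave at time \<open>t\<close> is the sum of
  \<open>2 \<parallel>(i/2) g e\<^bsup>i G/2\<^esup> e\<^bsup>- i G(\<cdot> - 2t)/2\<^esup> - f\<^sub>+'\<parallel>\<^sup>2\<close> and a similar term with \<open>G(\<cdot> + 2t)\<close> and \<open>f\<^sub>-'\<close>.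
  If \<open>G\<close> has limits and \<open>g\<close> is square integrable, dominated convergence applies. Conversely,
  scattering makes the two terms Cauchy in \<open>t\<close>. Without any energy bound on \<open>g\<close>, the second term
  forces the energy of \<open>g\<close> in windows of a fixed length to vanish at \<open>-\<infinity>\<close>, since the phase is not
  constant on some pair of windows; hence \<open>G\<close> oscillates little there. The first term, near a
  point where \<open>g \<noteq> 0\<close>, then shows that the phase \<open>e\<^bsup>i G/2\<^esup>\<close> is Cauchy at \<open>-\<infinity>\<close>, and so is \<open>G\<close> by
  continuity. Reflection handles \<open>+\<infinity>\<close>. Data without scattering: \<open>G(x) = ln (1 + x\<^sup>2) / 2\<close>.\<close>

section \<open>The Cauchy problem\<close>

lemma C1_spacetimeI:
  assumes "\<And>x t. ((\<lambda>y. \<psi> y t) has_vector_derivative a x t) (at x)"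
    and "\<And>x t. ((\<lambda>s. \<psi> x s) has_vector_derivative b x t) (at t)"
    and "continuous_on UNIV (\<lambda>(x, t). a x t)" "continuous_on UNIV (\<lambda>(x, t). b x t)"
  shows "C1_spacetime \<psi>" "Dx \<psi> = a" "Dt \<psi> = b"
proof -
  show *: "Dx \<psi> = a" "Dt \<psi> = b"
    using assms(1,2) by (auto simp: Dx_def Dt_def fun_eq_iff intro!: vector_derivative_at)
  show "C1_spacetime \<psi>"
    using assms differentiableI_vector unfolding C1_spacetime_def * by blast
qed

lemma C1_spacetime_Dx:
  assumes "C1_spacetime \<psi>"
  shows "((\<lambda>y. \<psi> y t) has_vector_derivative Dx \<psi> x t) (at x)"
  using assms by (simp add: C1_spacetime_def Dx_def vector_derivative_works)

lemma C1_spacetime_Dt: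
  assumes "C1_spacetime \<psi>"
  shows "((\<lambda>s. \<psi> x s) has_vector_derivative Dt \<psi> x t) (at t)"
  using assms by (simp add: C1_spacetime_def Dt_def vector_derivative_works)

lemma C1_spacetime_add:
  assumes "C1_spacetime \<phi>" "C1_spacetime \<psi>"
  shows "C1_spacetime (\<lambda>x t. \<phi> x t + \<psi> x t)"
proof (rule C1_spacetimeI)
  show "((\<lambda>y. \<phi> y t + \<psi> y t) has_vector_derivative Dx \<phi> x t + Dx \<psi> x t) (at x)" for x t
    by (intro has_vector_derivative_add C1_spacetime_Dx assms)
  show "((\<lambda>s. \<phi> x s + \<psi> x s) has_vector_derivative Dt \<phi> x t + Dt \<psi> x t) (at t)" for x t
    by (intro has_vector_derivative_add C1_spacetime_Dt assms)
qed (use assms in \<open>auto simp: C1_spacetime_def case_prod_unfold intro!: continuous_intros\<close>)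

lemma C1_spacetime_diff:
  assumes "C1_spacetime \<phi>" "C1_spacetime \<psi>"
  shows "C1_spacetime (\<lambda>x t. \<phi> x t - \<psi> x t)"
proof (rule C1_spacetimeI)
  show "((\<lambda>y. \<phi> y t - \<psi> y t) has_vector_derivative Dx \<phi> x t - Dx \<psi> x t) (at x)" for x t
    by (intro has_vector_derivative_diff C1_spacetime_Dx assms)
  show "((\<lambda>s. \<phi> x s - \<psi> x s) has_vector_derivative Dt \<phi> x t - Dt \<psi> x t) (at t)" for x t
    by (intro has_vector_derivative_diff C1_spacetime_Dt assms)
qed (use assms in \<open>auto simp: C1_spacetime_def case_prod_unfold intro!: continuous_intros\<close>)

lemma C1_spacetime_cmult:
  assumes "C1_spacetime \<phi>"
  shows "C1_spacetime (\<lambda>x t. c * \<phi> x t)"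
proof (rule C1_spacetimeI)
  show "((\<lambda>y. c * \<phi> y t) has_vector_derivative c * Dx \<phi> x t) (at x)" for x t
    by (intro has_vector_derivative_mult_right C1_spacetime_Dx assms)
  show "((\<lambda>s. c * \<phi> x s) has_vector_derivative c * Dt \<phi> x t) (at t)" for x t
    by (intro has_vector_derivative_mult_right C1_spacetime_Dt assms)
qed (use assms in \<open>auto simp: C1_spacetime_def case_prod_unfold intro!: continuous_intros\<close>)

text \<open>Joint continuity of the \<open>t\<close>-derivative upgrades the two partial derivatives
  to a total one. This is what permits differentiation along oblique lines, in particular null
  lines.\<close>

lemma C1_spacetime_has_derivative:
  assumes "C1_spacetime \<psi>"
  shows "((\<lambda>(x, t). \<psi> x t) has_derivative (\<lambda>(h, k). h *\<^sub>R Dx \<psi> x t + k *\<^sub>R Dt \<psi> x t)) (at (x, t))"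
proof -
  have "((\<lambda>(x, t). \<psi> x t) has_derivative
      (\<lambda>(h, k). h *\<^sub>R Dx \<psi> x t + blinfun_apply (blinfun_scaleR_left (Dt \<psi> x t)) k))
      (at (x, t) within UNIV \<times> UNIV)"
  proof (rule has_derivative_partialsI)
    show "((\<lambda>y. \<psi> y t) has_derivative (\<lambda>h. h *\<^sub>R Dx \<psi> x t)) (at x within UNIV)"
      using C1_spacetime_Dx[OF assms] by (simp add: has_vector_derivative_def)
    show "((\<lambda>s. \<psi> x s) has_derivative blinfun_apply (blinfun_scaleR_left (Dt \<psi> x t)))
        (at t within UNIV)" for x t
      using C1_spacetime_Dt[OF assms] by (simp add: has_vector_derivative_def)
    have "continuous_on UNIV (\<lambda>z. blinfun_scaleR_left (case z of (x, t) \<Rightarrow> Dt \<psi> x t))"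
      using assms by (intro continuous_intros) (simp add: C1_spacetime_def)
    then show "continuous (at (x, t) within UNIV \<times> UNIV) (\<lambda>(x, t). blinfun_scaleR_left (Dt \<psi> x t))"
      by (simp add: continuous_on_eq_continuous_within case_prod_unfold)
  qed auto
  then show ?thesis by simp
qed

lemma C1_spacetime_along_line:
  assumes "C1_spacetime \<psi>"
  shows "((\<lambda>s. \<psi> (a + h * s) (b + k * s)) has_vector_derivative
           h *\<^sub>R Dx \<psi> (a + h * s) (b + k * s) + k *\<^sub>R Dt \<psi> (a + h * s) (b + k * s)) (at s)"
proof -
  have "((\<lambda>s. (a + h * s, b + k * s)) has_derivative (\<lambda>r. (h * r, k * r))) (at s)"
    by (auto intro!: derivative_eq_intros)
  from has_derivative_compose[OF this C1_spacetime_has_derivative[OF assms]] show ?thesis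
    by (simp add: has_vector_derivative_def algebra_simps)
qed

text \<open>The factor 2 appears because the curve keeps \<open>v\<close> fixed and moves
  \<open>u\<close> at speed 2.\<close>

lemma has_vector_derivative_along_u:
  assumes "C1_spacetime \<psi>"
  shows "((\<lambda>s. \<psi> (a + s) (b + s)) has_vector_derivative 2 * Du \<psi> (a + s) (b + s)) (at s)"
  using C1_spacetime_along_line[OF assms, of a 1 b 1 s] by (simp add: Du_def add_divide_distrib)

lemma has_vector_derivative_along_v:
  assumes "C1_spacetime \<psi>"
  shows "((\<lambda>s. \<psi> (a + s) (b - s)) has_vector_derivative 2 * Dv \<psi> (a + s) (b - s)) (at s)"
  using C1_spacetime_along_line[OF assms, of a 1 b "-1" s] by (simp add: Dv_def diff_divide_distrib)

text \<open>Since \<open>A\<close> sees only \<open>u\<close> and \<open>B\<close> only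
  \<open>v\<close>, each null derivative falls on one factor. The explicit solution and both of its
  null derivatives are products of this kind, so the lemma serves for first and second derivatives
  alike.\<close>

lemma null_product:
  fixes A B :: "real \<Rightarrow> complex"
  assumes A: "\<And>x. (A has_vector_derivative A' x) (at x)" and B: "\<And>x. (B has_vector_derivative B' x) (at x)"
    and cA: "continuous_on UNIV A'" and cB: "continuous_on UNIV B'"
  defines "\<psi> \<equiv> \<lambda>x t. A (x + t) * B (x - t)"
  shows "C1_spacetime \<psi>"
    and "Dx \<psi> = (\<lambda>x t. A' (x + t) * B (x - t) + A (x + t) * B' (x - t))"
    and "Dt \<psi> = (\<lambda>x t. A' (x + t) * B (x - t) - A (x + t) * B' (x - t))"
    and "Du \<psi> = (\<lambda>x t. A' (x + t) * B (x - t))"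
    and "Dv \<psi> = (\<lambda>x t. A (x + t) * B' (x - t))"
proof -
  have cont: "continuous_on UNIV A" "continuous_on UNIV B"
    using A B by (auto intro: continuous_at_imp_continuous_on has_vector_derivative_continuous)
  have c2: "continuous_on UNIV (\<lambda>z::real \<times> real. F (fst z + snd z))"
    "continuous_on UNIV (\<lambda>z::real \<times> real. F (fst z - snd z))"
    if "continuous_on UNIV F" for F :: "real \<Rightarrow> complex"
    by (rule continuous_on_compose2[OF that]; auto intro!: continuous_intros)+
  have dp: "((\<lambda>y. F (y + t)) has_vector_derivative F' (x + t)) (at x)"
    "((\<lambda>s. F (x + s)) has_vector_derivative F' (x + t)) (at t)"
    "((\<lambda>y. F (y - t)) has_vector_derivative F' (x - t)) (at x)"
    "((\<lambda>s. F (x - s)) has_vector_derivative - F' (x - t)) (at t)"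
    if F: "\<And>x. (F has_vector_derivative F' x) (at x)" for F F' :: "real \<Rightarrow> complex" and x t
  proof -
    have 1: "((\<lambda>y. F (h y)) has_vector_derivative d *\<^sub>R F' (h z)) (at z)"
      if "(h has_real_derivative d) (at z)" for h d z
      using vector_diff_chain_at[OF that[unfolded has_real_derivative_iff_has_vector_derivative] F]
      by (simp add: o_def)
    show "((\<lambda>y. F (y + t)) has_vector_derivative F' (x + t)) (at x)"
      "((\<lambda>s. F (x + s)) has_vector_derivative F' (x + t)) (at t)"
      "((\<lambda>y. F (y - t)) has_vector_derivative F' (x - t)) (at x)"
      "((\<lambda>s. F (x - s)) has_vector_derivative - F' (x - t)) (at t)"
      using 1[of "\<lambda>y. y + t" 1 x, OF DERIV_cong] 1[of "\<lambda>s. x + s" 1 t, OF DERIV_cong]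
        1[of "\<lambda>y. y - t" 1 x, OF DERIV_cong] 1[of "\<lambda>s. x - s" "-1" t, OF DERIV_cong]
      by (force intro!: derivative_eq_intros)+
  qed
  have dX: "((\<lambda>y. \<psi> y t) has_vector_derivative A' (x + t) * B (x - t) + A (x + t) * B' (x - t)) (at x)" for x t
    using has_vector_derivative_mult[OF dp(1)[OF A, of t x] dp(3)[OF B, of t x]]
    by (simp add: \<psi>_def algebra_simps)
  have dT: "((\<lambda>s. \<psi> x s) has_vector_derivative A' (x + t) * B (x - t) - A (x + t) * B' (x - t)) (at t)" for x t
    using has_vector_derivative_mult[OF dp(2)[OF A, of x t] dp(4)[OF B, of x t]]
    by (simp add: \<psi>_def algebra_simps)
  have k: "continuous_on UNIV (\<lambda>(x, t). A' (x + t) * B (x - t) + A (x + t) * B' (x - t))"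
    "continuous_on UNIV (\<lambda>(x, t). A' (x + t) * B (x - t) - A (x + t) * B' (x - t))"
    unfolding case_prod_unfold by (intro continuous_intros c2 cont cA cB)+
  show 0: "C1_spacetime \<psi>"
    and 1: "Dx \<psi> = (\<lambda>x t. A' (x + t) * B (x - t) + A (x + t) * B' (x - t))"
    and 2: "Dt \<psi> = (\<lambda>x t. A' (x + t) * B (x - t) - A (x + t) * B' (x - t))"
    by (rule C1_spacetimeI[OF dX dT k])+
  show "Du \<psi> = (\<lambda>x t. A' (x + t) * B (x - t))" "Dv \<psi> = (\<lambda>x t. A (x + t) * B' (x - t))"
    by (auto simp: Du_def Dv_def 1 2 fun_eq_iff)
qed

section \<open>Every solution is given by the explicit phase formula\<close>

lemma has_vector_derivative_cis:
  assumes "(f has_real_derivative d) (at x)"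
  shows "((\<lambda>x. cis (f x)) has_vector_derivative \<i> * d * cis (f x)) (at x)"
proof -
  have "(f has_derivative (\<lambda>h. d * h)) (at x)"
    using assms by (simp add: has_field_derivative_def)
  from has_derivative_cis[OF this] show ?thesis
    by (simp add: has_vector_derivative_def scaleR_conv_of_real algebra_simps)
qed

text \<open>Both \<open>a\<close> and \<open>b\<close> are tangent to the circle at
  \<open>z\<close>, hence real multiples of \<open>\<i> * z\<close>, so their Hermitian product has
  no imaginary part. This turns the inner product of the wave map equation into a complex
  product.\<close>

lemma inner_mult_orthogonal:
  fixes z a b :: complex
  assumes "norm z = 1" "z \<bullet> a = 0" "z \<bullet> b = 0"
  shows "cnj a * b = of_real (a \<bullet> b)"
proof -
  have z: "(Re z)\<^sup>2 + (Im z)\<^sup>2 = 1"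
    using assms(1) by (simp add: cmod_def)
  have 1: "Re z * Re a + Im z * Im a = 0" "Re z * Re b + Im z * Im b = 0"
    using assms(2,3) by (auto simp: inner_complex_def)
  \<comment> \<open>The determinant of \<open>a\<close> and \<open>b\<close>, multiplied by the
    squared norm 1 of \<open>z\<close>, is a combination of the two vanishing inner
    products.\<close>
  have "Re a * Im b - Im a * Re b = ((Re z)\<^sup>2 + (Im z)\<^sup>2) * (Re a * Im b - Im a * Re b)"
    by (simp add: z)
  also have "\<dots> = (Re z * Re a + Im z * Im a) * (Re z * Im b - Im z * Re b)
                - (Re z * Re b + Im z * Im b) * (Re z * Im a - Im z * Re a)"
    by (simp add: power2_eq_square algebra_simps)
  finally have "Re a * Im b = Im a * Re b" using 1 by simp
  then show ?thesis by (simp add: complex_eq_iff inner_complex_def)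
qed

text \<open>Differentiate the constraint \<open>\<phi> \<bullet> \<phi> = 1\<close> in
  \<open>x\<close> and in \<open>t\<close>; the null derivatives are combinations of these.\<close>

lemma circle_wave_map_inner:
  assumes "circle_wave_map f h \<phi>"
  shows "\<phi> x t \<bullet> Du \<phi> x t = 0" "\<phi> x t \<bullet> Dv \<phi> x t = 0"
proof -
  have C: "C1_spacetime \<phi>" and n: "\<phi> x t \<bullet> \<phi> x t = 1" for x t
    using assms by (auto simp: circle_wave_map_def C2_spacetime_def dot_square_norm)
  have key: "z s \<bullet> d = 0" if z: "(z has_vector_derivative d) (at s)" and 1: "\<And>s. z s \<bullet> z s = 1"
    for z :: "real \<Rightarrow> complex" and d s
  proof -
    have "((\<lambda>s. z s \<bullet> z s) has_vector_derivative z s \<bullet> d + d \<bullet> z s) (at s)"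
      using bounded_bilinear.has_vector_derivative[OF bounded_bilinear_inner z z] .
    then have "((\<lambda>s. 1::real) has_vector_derivative z s \<bullet> d + d \<bullet> z s) (at s)"
      by (simp add: 1)
    then have "z s \<bullet> d + d \<bullet> z s = 0"
      using vector_derivative_unique_at has_vector_derivative_const by blast
    then show ?thesis by (simp add: inner_commute)
  qed
  have "\<phi> x t \<bullet> Dx \<phi> x t = 0" "\<phi> x t \<bullet> Dt \<phi> x t = 0"
    using key[OF C1_spacetime_Dx[OF C]] key[OF C1_spacetime_Dt[OF C]] n by auto
  then show "\<phi> x t \<bullet> Du \<phi> x t = 0" "\<phi> x t \<bullet> Dv \<phi> x t = 0"
    by (simp_all add: Du_def Dv_def inner_complex_def algebra_simps flip: add_divide_distrib)
qed

text \<open>The \<open>u\<close>-derivative of \<open>cnj \<phi> * Dv \<phi>\<close> has two terms: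
  one equals the inner product of the null derivatives by tangency, the other its negative by the
  equation. The conserved quantity is then read off at time 0, where the \<open>x\<close>-derivative
  vanishes.\<close>

lemma circle_wave_map_Dv:
  assumes W: "circle_wave_map (\<lambda>x. 1) (\<lambda>x. \<i> * complex_of_real (g x)) \<phi>"
  shows "Dv \<phi> x t = - (\<i> * g (x - t) / 2) * \<phi> x t"
proof -
  have C: "C1_spacetime \<phi>" "C1_spacetime (Dx \<phi>)" "C1_spacetime (Dt \<phi>)"
    and n: "\<And>x t. norm (\<phi> x t) = 1"
    and eq: "\<And>x t. Du (Dv \<phi>) x t = - ((Du \<phi> x t \<bullet> Dv \<phi> x t) *\<^sub>R \<phi> x t)"
    and init: "\<And>x. \<phi> x 0 = 1" "\<And>x. Dt \<phi> x 0 = \<i> * g x"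
    using W by (auto simp: circle_wave_map_def C2_spacetime_def)
  have Cv: "C1_spacetime (Dv \<phi>)"
    using C1_spacetime_cmult[OF C1_spacetime_diff[OF C(2,3)], of "1/2"]
    by (simp add: Dv_def[abs_def])
  \<comment> \<open>The curve is the line of constant \<open>v\<close> through the point
    \<open>(x, t)\<close>, parametrized by time: \<open>s = 0\<close> is the initial line and
    \<open>s = t\<close> the given point.\<close>
  define B where "B s = cnj (\<phi> (x - t + s) s) * Dv \<phi> (x - t + s) s" for s
  have unit: "cnj (\<phi> x t) * \<phi> x t = 1" for x t
    using n[of x t] by (metis complex_norm_square mult.commute of_real_1 power_one)
  have "(B has_vector_derivative 0) (at s)" for s
  proof -
    let ?x = "x - t + s"
    have d: "((\<lambda>s. \<phi> (x - t + s) s) has_vector_derivative 2 * Du \<phi> ?x s) (at s)"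
      "((\<lambda>s. Dv \<phi> (x - t + s) s) has_vector_derivative 2 * Du (Dv \<phi>) ?x s) (at s)"
      using has_vector_derivative_along_u[OF C(1), of "x - t" 0 s] has_vector_derivative_along_u[OF Cv, of "x - t" 0 s] by simp_all
    have "(B has_vector_derivative cnj (\<phi> ?x s) * (2 * Du (Dv \<phi>) ?x s)
        + cnj (2 * Du \<phi> ?x s) * Dv \<phi> ?x s) (at s)"
      unfolding B_def
      using has_vector_derivative_mult[OF has_vector_derivative_cnj[OF d(1)] d(2)]
      by simp
    moreover have "cnj (Du \<phi> ?x s) * Dv \<phi> ?x s = of_real (Du \<phi> ?x s \<bullet> Dv \<phi> ?x s)"
      by (rule inner_mult_orthogonal[OF n circle_wave_map_inner[OF W]])
    moreover have "cnj (\<phi> ?x s) * Du (Dv \<phi>) ?x s = - of_real (Du \<phi> ?x s \<bullet> Dv \<phi> ?x s)"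
      using unit[of ?x s] by (simp add: eq scaleR_conv_of_real)
    ultimately show ?thesis
      by (simp add: mult.left_commute[of _ 2] mult.assoc)
  qed
  then obtain c where "\<And>s. B s = c"
    using has_vector_derivative_zero_constant[of UNIV B] by auto
  then have "B t = B 0" by simp
  moreover have "Dx \<phi> y 0 = 0" for y
    by (simp add: Dx_def init(1))
  ultimately have "cnj (\<phi> x t) * Dv \<phi> x t = - (\<i> * g (x - t) / 2)"
    by (simp add: B_def Dv_def init)
  then have "(cnj (\<phi> x t) * \<phi> x t) * Dv \<phi> x t = - (\<i> * g (x - t) / 2) * \<phi> x t"
    by (simp add: mult.commute mult.left_commute)
  then show ?thesis by (simp add: unit)
qed

text \<open>In null coordinates this is \<open>cis ((G u - G v) / 2)\<close>. It is kept factored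
  into a function of \<open>u\<close> and a function of \<open>v\<close> so that
  \<open>null_product\<close> applies.\<close>

definition phase_wave :: "(real \<Rightarrow> real) \<Rightarrow> real \<Rightarrow> real \<Rightarrow> complex" where
  "phase_wave G x t = cis (G (x + t) / 2) * cis (- (G (x - t) / 2))"

text \<open>On lines of constant \<open>u\<close> the formula for \<open>Dv \<phi>\<close> is a
  linear ordinary differential equation in \<open>v\<close>, with integrating factor
  \<open>cis (G v / 2)\<close>.\<close>

lemma circle_wave_map_unique:
  assumes W: "circle_wave_map (\<lambda>x. 1) (\<lambda>x. \<i> * complex_of_real (g x)) \<phi>"
    and G: "\<And>x. (G has_real_derivative g x) (at x)"
  shows "\<phi> = phase_wave G"
proof (intro ext)
  fix x t
  have C: "C1_spacetime \<phi>" and init: "\<And>x. \<phi> x 0 = 1"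
    using W by (auto simp: circle_wave_map_def C2_spacetime_def)
  \<comment> \<open>Along this curve \<open>u = x + t\<close> is fixed and
    \<open>v = x - t + 2 * s\<close>. The value \<open>s = 0\<close> gives the point itself and
    \<open>s = t\<close> the initial line, where \<open>\<phi> = 1\<close>.\<close>
  define E where "E s = \<phi> (x + s) (t - s) * cis (G (x - t + 2 * s) / 2)" for s
  have "(E has_vector_derivative 0) (at s)" for s
  proof -
    have "((\<lambda>s. G (x - t + 2 * s) / 2) has_real_derivative g (x - t + 2 * s)) (at s)"
      by (rule derivative_eq_intros DERIV_chain2[OF G] refl | simp)+
    from has_vector_derivative_mult[OF has_vector_derivative_along_v[OF C, of x t s] has_vector_derivative_cis[OF this]]
    have "(E has_vector_derivative \<phi> (x + s) (t - s) * (\<i> * g (x - t + 2 * s) * cis (G (x - t + 2 * s) / 2)) +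
        2 * Dv \<phi> (x + s) (t - s) * cis (G (x - t + 2 * s) / 2)) (at s)"
      by (simp add: E_def[abs_def])
    moreover have "x + s - (t - s) = x - t + 2 * s" by simp
    ultimately show ?thesis
      using circle_wave_map_Dv[OF W, of "x + s" "t - s"] by (simp add: algebra_simps)
  qed
  then obtain c where "\<And>s. E s = c"
    using has_vector_derivative_zero_constant[of UNIV E] by auto
  then have "E 0 = E t" by simp
  then have "\<phi> x t * cis (G (x - t) / 2) = cis (G (x + t) / 2)"
    by (simp add: E_def init add.commute)
  then have "\<phi> x t * (cis (G (x - t) / 2) * cis (- (G (x - t) / 2))) = phase_wave G x t"
    by (simp add: phase_wave_def mult.assoc[symmetric])
  then show "\<phi> x t = phase_wave G x t"
    by (simp add: cis_mult)
qed

section \<open>Existence: derivatives of the phase wave and verification of the equation\<close>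

lemma has_vector_derivative_cis_half:
  assumes "\<And>x. (G has_real_derivative g x) (at x)"
  shows "((\<lambda>x. cis (G x / 2)) has_vector_derivative \<i> * (g x / 2) * cis (G x / 2)) (at x)"
    and "((\<lambda>x. cis (- (G x / 2))) has_vector_derivative - (\<i> * (g x / 2) * cis (- (G x / 2)))) (at x)"
proof -
  have "((\<lambda>x. G x / 2) has_real_derivative g x / 2) (at x)"
    "((\<lambda>x. - (G x / 2)) has_real_derivative - (g x / 2)) (at x)"
    by (auto intro!: derivative_eq_intros assms)
  from this[THEN has_vector_derivative_cis]
  show "((\<lambda>x. cis (G x / 2)) has_vector_derivative \<i> * (g x / 2) * cis (G x / 2)) (at x)"
    "((\<lambda>x. cis (- (G x / 2))) has_vector_derivative - (\<i> * (g x / 2) * cis (- (G x / 2)))) (at x)"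
    by simp_all
qed

lemma phase_wave_derivs:
  assumes G: "\<And>x. (G has_real_derivative g x) (at x)" and g: "continuous_on UNIV g"
  shows "C1_spacetime (phase_wave G)"
    and "Dx (phase_wave G) = (\<lambda>x t. \<i> * (g (x + t) / 2) * cis (G (x + t) / 2) * cis (- (G (x - t) / 2))
       + cis (G (x + t) / 2) * - (\<i> * (g (x - t) / 2) * cis (- (G (x - t) / 2))))"
    and "Dt (phase_wave G) = (\<lambda>x t. \<i> * (g (x + t) / 2) * cis (G (x + t) / 2) * cis (- (G (x - t) / 2))
       - cis (G (x + t) / 2) * - (\<i> * (g (x - t) / 2) * cis (- (G (x - t) / 2))))"
    and "Du (phase_wave G) = (\<lambda>x t. \<i> * (g (x + t) / 2) * cis (G (x + t) / 2) * cis (- (G (x - t) / 2)))"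
    and "Dv (phase_wave G) = (\<lambda>x t. cis (G (x + t) / 2) * - (\<i> * (g (x - t) / 2) * cis (- (G (x - t) / 2))))"
proof -
  have "continuous_on UNIV G"
    using G by (auto intro: continuous_at_imp_continuous_on DERIV_isCont)
  then have "continuous_on UNIV (\<lambda>x. \<i> * (g x / 2) * cis (G x / 2))"
    "continuous_on UNIV (\<lambda>x. - (\<i> * (g x / 2) * cis (- (G x / 2))))"
    by (auto intro!: continuous_intros g)
  note * = null_product[OF has_vector_derivative_cis_half(1)[OF G] has_vector_derivative_cis_half(2)[OF G] this]
  have eq: "phase_wave G = (\<lambda>x t. cis (G (x + t) / 2) * cis (- (G (x - t) / 2)))"
    by (simp add: phase_wave_def fun_eq_iff)
  show "C1_spacetime (phase_wave G)"
    and "Dx (phase_wave G) = (\<lambda>x t. \<i> * (g (x + t) / 2) * cis (G (x + t) / 2) * cis (- (G (x - t) / 2))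
       + cis (G (x + t) / 2) * - (\<i> * (g (x - t) / 2) * cis (- (G (x - t) / 2))))"
    and "Dt (phase_wave G) = (\<lambda>x t. \<i> * (g (x + t) / 2) * cis (G (x + t) / 2) * cis (- (G (x - t) / 2))
       - cis (G (x + t) / 2) * - (\<i> * (g (x - t) / 2) * cis (- (G (x - t) / 2))))"
    and "Du (phase_wave G) = (\<lambda>x t. \<i> * (g (x + t) / 2) * cis (G (x + t) / 2) * cis (- (G (x - t) / 2)))"
    and "Dv (phase_wave G) = (\<lambda>x t. cis (G (x + t) / 2) * - (\<i> * (g (x - t) / 2) * cis (- (G (x - t) / 2))))"
    unfolding eq by (fact *)+
qed

text \<open>Both null derivatives are real multiples of \<open>\<i> * \<phi>\<close>, with
  coefficients \<open>g u / 2\<close> and \<open>- (g v / 2)\<close>, so both sides of the equation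
  equal \<open>g u * g v / 4\<close> times \<open>\<phi>\<close>.\<close>

lemma phase_wave_circle_wave_map:
  assumes G: "\<And>x. (G has_real_derivative g x) (at x)"
    and g: "\<And>x. (g has_real_derivative g' x) (at x)" and g': "continuous_on UNIV g'"
  shows "circle_wave_map (\<lambda>x. 1) (\<lambda>x. \<i> * complex_of_real (g x)) (phase_wave G)"
proof -
  define A where "A x = cis (G x / 2)" for x
  define B where "B x = cis (- (G x / 2))" for x
  define A' where "A' x = \<i> * (g x / 2) * A x" for x
  define B' where "B' x = - (\<i> * (g x / 2) * B x)" for x
  have cg: "continuous_on UNIV g" and cG: "continuous_on UNIV G"
    using G g by (auto intro: continuous_at_imp_continuous_on DERIV_isCont)
  note D = phase_wave_derivs[OF G cg, folded A_def B_def, folded A'_def B'_def]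
  have AB: "(A has_vector_derivative A' x) (at x)" "(B has_vector_derivative B' x) (at x)" for x
    using has_vector_derivative_cis_half[OF G, of x] by (simp_all add: A_def[abs_def] B_def[abs_def] A'_def B'_def)
  have gc: "((\<lambda>x. complex_of_real (g x / 2)) has_vector_derivative g' x / 2) (at x)" for x
    by (rule has_vector_derivative_eq_rhs[OF has_vector_derivative_of_real[OF DERIV_cdivide[OF g]]]) simp
  define A'' where "A'' x = \<i> * (g' x / 2) * A x + \<i> * (g x / 2) * A' x" for x
  define B'' where "B'' x = - (\<i> * (g' x / 2) * B x + \<i> * (g x / 2) * B' x)" for x
  have A2: "(A' has_vector_derivative A'' x) (at x)" for x
    using has_vector_derivative_mult[OF has_vector_derivative_mult_right[OF gc, of \<i>] AB(1)[of x]]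
    by (simp add: A'_def[abs_def] A''_def add.commute)
  have B2: "(B' has_vector_derivative B'' x) (at x)" for x
    using has_vector_derivative_minus[OF has_vector_derivative_mult[OF has_vector_derivative_mult_right[OF gc, of \<i>] AB(2)[of x]]]
    by (simp add: B'_def[abs_def] B''_def)
  have cont: "continuous_on UNIV A" "continuous_on UNIV B"
    by (auto intro!: continuous_intros cG simp: A_def[abs_def] B_def[abs_def])
  have cont': "continuous_on UNIV A'" "continuous_on UNIV B'"
    by (auto intro!: continuous_intros cg cont simp: A'_def[abs_def] B'_def[abs_def])
  have cont'': "continuous_on UNIV A''" "continuous_on UNIV B''"
    by (auto intro!: continuous_intros cg g' cont cont' simp: A''_def[abs_def] B''_def[abs_def])
  \<comment> \<open>\<open>N1\<close> treats \<open>Du\<close> and \<open>N2\<close> treats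
    \<open>Dv\<close> of the phase wave; \<open>Dx\<close> is their sum and \<open>Dt\<close> their
    difference, which yields the second-order regularity.\<close>
  note N1 = null_product[OF A2 AB(2) cont''(1) cont'(2)]
  note N2 = null_product[OF AB(1) B2 cont'(1) cont''(2)]
  have "C2_spacetime (phase_wave G)"
    unfolding C2_spacetime_def
    using D(1) C1_spacetime_add[OF N1(1) N2(1)] C1_spacetime_diff[OF N1(1) N2(1)] by (simp add: D(2,3))
  moreover have "Du (Dv (phase_wave G)) x t =
      - ((Du (phase_wave G) x t \<bullet> Dv (phase_wave G) x t) *\<^sub>R phase_wave G x t)" for x t
  proof -
    let ?z = "A (x + t) * B (x - t)"
    have "norm ?z = 1" by (simp add: A_def B_def norm_mult)
    then have "(Re ?z)\<^sup>2 + (Im ?z)\<^sup>2 = 1" by (metis cmod_power2 power_one)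
    then have one: "?z \<bullet> ?z = 1" by (simp add: inner_complex_def power2_eq_square)
    have u: "Du (phase_wave G) x t = (g (x + t) / 2) *\<^sub>R (\<i> * ?z)"
      by (simp add: D(4) A'_def scaleR_conv_of_real)
    have v: "Dv (phase_wave G) x t = - (g (x - t) / 2) *\<^sub>R (\<i> * ?z)"
      by (simp add: D(5) B'_def scaleR_conv_of_real)
    have "(\<i> * w) \<bullet> (\<i> * w) = w \<bullet> w" for w :: complex
      by (simp add: inner_complex_def)
    with one have "(\<i> * ?z) \<bullet> (\<i> * ?z) = 1"
      by simp
    then have "Du (phase_wave G) x t \<bullet> Dv (phase_wave G) x t = - (g (x + t) / 2) * (g (x - t) / 2)"
      unfolding u v by simp
    moreover have "Du (Dv (phase_wave G)) x t = A' (x + t) * B' (x - t)"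
      using N2(4) by (simp add: D(5))
    moreover have "phase_wave G x t = ?z" by (simp add: phase_wave_def A_def B_def)
    ultimately show ?thesis
      by (simp add: A'_def B'_def scaleR_conv_of_real mult_ac)
  qed
  moreover have "norm (phase_wave G x t) = 1" for x t
    by (simp add: phase_wave_def norm_mult)
  moreover have "phase_wave G x 0 = 1" for x
    by (simp add: phase_wave_def cis_mult)
  moreover have "Dt (phase_wave G) x 0 = \<i> * g x" for x
    by (simp add: D(3) A'_def B'_def) (simp add: A_def B_def cis_mult mult.assoc[symmetric])
  ultimately show ?thesis by (simp add: circle_wave_map_def)
qed

section \<open>Correlations with a translated phase\<close>

lemma norm_cis_diff_sq: "(norm (cis a - cis b))\<^sup>2 = 2 - 2 * cos (a - b)"
proof -
  have "(norm (cis a - cis b))\<^sup>2 = (cos a - cos b)\<^sup>2 + (sin a - sin b)\<^sup>2"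
    by (simp add: cmod_power2)
  also have "\<dots> = ((cos a)\<^sup>2 + (sin a)\<^sup>2) + ((cos b)\<^sup>2 + (sin b)\<^sup>2) - 2 * (cos a * cos b + sin a * sin b)"
    by (simp only: power2_eq_square) (simp add: algebra_simps)
  finally show ?thesis by (simp add: cos_diff)
qed

lemma norm_cis_diff: "norm (cis a - cis b) = 2 * \<bar>sin ((a - b) / 2)\<bar>"
proof -
  have "2 * ((a - b) / 2) = a - b" by simp
  then have "cos (a - b) = 1 - 2 * (sin ((a - b) / 2))\<^sup>2"
    using cos_double_sin by metis
  then have "(norm (cis a - cis b))\<^sup>2 = 4 * (sin ((a - b) / 2))\<^sup>2"
    by (simp add: norm_cis_diff_sq)
  then have "(norm (cis a - cis b))\<^sup>2 = (2 * \<bar>sin ((a - b) / 2)\<bar>)\<^sup>2"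
    by (simp add: power_mult_distrib)
  then show ?thesis
    by (rule power2_eq_imp_eq) auto
qed

lemma norm_cis_diff_le: "norm (cis a - cis b) \<le> \<bar>a - b\<bar>"
  using abs_sin_x_le_abs_x[of "(a - b) / 2"] by (simp add: norm_cis_diff)

text \<open>Completeness gives a limit along the sequence \<open>- real n\<close>, and the uniform
  Cauchy bound carries it over to the whole filter.\<close>

lemma Cauchy_at_bot_convergent:
  fixes f :: "real \<Rightarrow> real"
  assumes "\<And>e. e > 0 \<Longrightarrow> \<exists>S. \<forall>a\<le>S. \<forall>b\<le>S. \<bar>f a - f b\<bar> \<le> e"
  shows "\<exists>l. (f \<longlongrightarrow> l) at_bot"
proof -
  have "Cauchy (\<lambda>n. f (- real n))"
  proof (rule metric_CauchyI)
    fix e :: real assume "e > 0"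
    then obtain S where S: "\<forall>a\<le>S. \<forall>b\<le>S. \<bar>f a - f b\<bar> \<le> e / 2"
      using assms[of "e / 2"] by auto
    obtain N where N: "real N \<ge> - S" using real_arch_simple by blast
    have "dist (f (- real m)) (f (- real n)) < e" if "m \<ge> N" "n \<ge> N" for m n
    proof -
      have "- real m \<le> S" "- real n \<le> S" using that N by linarith+
      then show ?thesis using S \<open>e > 0\<close> by (fastforce simp: dist_real_def)
    qed
    then show "\<exists>M. \<forall>m\<ge>M. \<forall>n\<ge>M. dist (f (- real m)) (f (- real n)) < e" by blast
  qed
  then obtain l where l: "(\<lambda>n. f (- real n)) \<longlonglongrightarrow> l"
    using Cauchy_convergent_iff convergent_def by blast
  have "(f \<longlongrightarrow> l) at_bot"
  proof (rule tendstoI)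
    fix e :: real assume "e > 0"
    then obtain S where S: "\<forall>a\<le>S. \<forall>b\<le>S. \<bar>f a - f b\<bar> \<le> e / 2"
      using assms[of "e / 2"] by auto
    have "dist (f x) l < e" if "x \<le> S" for x
    proof -
      have "(\<lambda>n. \<bar>f x - f (- real n)\<bar>) \<longlonglongrightarrow> \<bar>f x - l\<bar>"
        by (intro tendsto_intros l)
      moreover obtain N where "real N \<ge> - S" using real_arch_simple by blast
      then have "\<forall>n\<ge>N. \<bar>f x - f (- real n)\<bar> \<le> e / 2"
        using S that by (smt (verit) of_nat_mono)
      ultimately have "\<bar>f x - l\<bar> \<le> e / 2"
        using LIMSEQ_le_const2 by blast
      then show ?thesis using \<open>e > 0\<close> by (simp add: dist_real_def)
    qed
    then show "\<forall>\<^sub>F x in at_bot. dist (f x) l < e"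
      using eventually_at_bot_linorder by blast
  qed
  then show ?thesis by blast
qed

text \<open>The identity \<open>\<bar>cis (a/2) - cis (b/2)\<bar> = 2 \<bar>sin ((a - b)/4)\<bar>\<close> only controls \<open>G\<close> modulo \<open>4\<pi>\<close>;
  a jump between sheets is excluded by the intermediate value theorem.\<close>

lemma Cauchy_phase_imp_Cauchy:
  fixes G :: "real \<Rightarrow> real"
  assumes G: "continuous_on UNIV G"
    and C: "\<And>e. e > 0 \<Longrightarrow> \<exists>S. \<forall>a\<le>S. \<forall>b\<le>S. norm (cis (G a / 2) - cis (G b / 2)) \<le> e"
    and "d > 0"
  shows "\<exists>S. \<forall>a\<le>S. \<forall>b\<le>S. \<bar>G a - G b\<bar> \<le> d"
proof -
  \<comment> \<open>The cap at 1 makes \<open>sin (r / 4)\<close> positive. A difference of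
    \<open>G\<close> of size exactly \<open>r\<close> produces the chord
    \<open>2 * sin (r / 4)\<close>, twice the tolerance \<open>sin (r / 4)\<close> chosen
    below.\<close>
  define r where "r = min d 1"
  have r: "0 < r" "r \<le> d" "r \<le> 1" using \<open>d > 0\<close> by (auto simp: r_def)
  have s: "sin (r / 4) > 0"
    using r pi_gt3 by (intro sin_gt_zero) auto
  then obtain S where S: "\<forall>a\<le>S. \<forall>b\<le>S. norm (cis (G a / 2) - cis (G b / 2)) \<le> sin (r / 4)"
    using C by blast
  have "\<bar>G a - G b\<bar> < r" if "a \<le> S" "b \<le> S" for a b
  proof (rule ccontr)
    assume neg: "\<not> \<bar>G a - G b\<bar> < r"
    have conn: "connected ((\<lambda>s. \<bar>G s - G b\<bar>) ` {..S})"
      by (intro connected_continuous_image continuous_intros continuous_on_subset[OF G]) auto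
    have "r \<in> (\<lambda>s. \<bar>G s - G b\<bar>) ` {..S}"
      using connectedD_interval[OF conn, of 0 "\<bar>G a - G b\<bar>" r] that neg r by force
    then obtain s where "s \<le> S" and eq: "\<bar>G s - G b\<bar> = r" by auto
    then have "norm (cis (G s / 2) - cis (G b / 2)) \<le> sin (r / 4)" using S that by blast
    moreover have "norm (cis (G s / 2) - cis (G b / 2)) = 2 * sin (r / 4)"
    proof -
      have "G s - G b = r \<or> G s - G b = - r" using eq by linarith
      then have "\<bar>sin ((G s - G b) / 4)\<bar> = sin (r / 4)" using s by auto
      then show ?thesis by (simp add: norm_cis_diff flip: diff_divide_distrib)
    qed
    ultimately show False using s by simp
  qed
  then show ?thesis using r by (meson less_imp_le order_trans)
qed

text \<open>The integral is the squared \<open>L^2\<close> distance between the profiles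
  \<open>g u * cis (G (u + \<sigma> * s) / 2)\<close> at two shifts. It is formed in the extended
  reals so that it makes sense for \<open>g\<close> of infinite energy; the value 1 or -1 of
  \<sigma> selects the direction of translation.\<close>

definition Cauchy_correlation :: "(real \<Rightarrow> real) \<Rightarrow> (real \<Rightarrow> real) \<Rightarrow> real \<Rightarrow> bool" where
  "Cauchy_correlation g G \<sigma> \<longleftrightarrow> (\<forall>e>0. \<exists>T. \<forall>s\<ge>T. \<forall>s'\<ge>T.
     (\<integral>\<^sup>+u. ennreal ((g u)\<^sup>2 * (norm (cis (G (u + \<sigma> * s) / 2) - cis (G (u + \<sigma> * s') / 2)))\<^sup>2) \<partial>lborel)
       \<le> ennreal e)"

section \<open>Limits of the primitive from Cauchy correlations\<close>

lemma nn_integral_ge_on_interval: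
  fixes f K k :: "real \<Rightarrow> real"
  assumes K: "\<And>x. (K has_real_derivative k x) (at x)" and k: "k \<in> borel_measurable borel"
    and nonneg: "\<And>x. k x \<ge> 0" and "a \<le> b" and le: "\<And>x. a \<le> x \<Longrightarrow> x \<le> b \<Longrightarrow> k x \<le> f x"
    and I: "(\<integral>\<^sup>+x. ennreal (f x) \<partial>lborel) \<le> ennreal e" and "e \<ge> 0"
  shows "K b - K a \<le> e"
proof -
  have "ennreal (K b - K a) = (\<integral>\<^sup>+x. ennreal (k x) * indicator {a..b} x \<partial>lborel)"
    using nn_integral_FTC_Icc[OF k K nonneg \<open>a \<le> b\<close>] by simp
  also have "\<dots> \<le> (\<integral>\<^sup>+x. ennreal (f x) \<partial>lborel)"
    by (intro nn_integral_mono) (auto split: split_indicator intro!: ennreal_leI le)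
  finally show ?thesis
    using I \<open>e \<ge> 0\<close> by (meson ennreal_le_iff order_trans)
qed

text \<open>If the phase differs at \<open>p\<close> and \<open>q\<close>, it differs by at least
  some \<open>c\<close> on whole windows around them. Two large shifts that carry a window near
  minus infinity onto these two windows bound its energy by the correlation integral divided by
  \<open>c\<^sup>2\<close>.\<close>

lemma window_energy_at_bot:
  assumes G: "\<And>x. (G has_real_derivative g x) (at x)" and g: "continuous_on UNIV g"
    and K: "\<And>x. (K has_real_derivative (g x)\<^sup>2) (at x)"
    and C: "Cauchy_correlation g G 1" and nz: "g z \<noteq> 0"
  obtains L where "L > 0" "\<And>e. e > 0 \<Longrightarrow> \<exists>S. \<forall>s\<le>S. K (s + L) - K (s - L) \<le> e"
proof -
  have cG: "continuous_on UNIV G"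
    using G by (auto intro: continuous_at_imp_continuous_on DERIV_isCont)
  \<comment> \<open>A constant phase would have derivative zero, contradicting
    \<open>g z \<noteq> 0\<close>.\<close>
  have "\<exists>p q. cis (G p / 2) \<noteq> cis (G q / 2)"
  proof (rule ccontr)
    assume "\<not> ?thesis"
    then have "(\<lambda>x. cis (G x / 2)) = (\<lambda>x. cis (G z / 2))" by auto
    with has_vector_derivative_cis_half(1)[OF G, of z]
    have "((\<lambda>x. cis (G z / 2)) has_vector_derivative \<i> * (g z / 2) * cis (G z / 2)) (at z)" by simp
    then have "\<i> * (g z / 2) * cis (G z / 2) = 0"
      using vector_derivative_unique_at has_vector_derivative_const by blast
    then show False using nz by simp
  qed
  then obtain p q where pq: "cis (G p / 2) \<noteq> cis (G q / 2)" by blast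
  \<comment> \<open>Half of the distance at \<open>y = 0\<close>, so that by continuity the distance
    exceeds \<open>c\<close> for small \<open>y\<close>.\<close>
  define c where "c = norm (cis (G p / 2) - cis (G q / 2)) / 2"
  have "c > 0" using pq by (simp add: c_def)
  have "isCont (\<lambda>y. norm (cis (G (p + y) / 2) - cis (G (q + y) / 2))) 0"
  proof -
    have "continuous_on UNIV (\<lambda>y. norm (cis (G (p + y) / 2) - cis (G (q + y) / 2)))"
      by (intro continuous_intros continuous_on_compose2[OF cG]) auto
    then show ?thesis by (simp add: continuous_on_eq_continuous_at)
  qed
  then have "\<forall>\<^sub>F y in at 0. norm (cis (G (p + y) / 2) - cis (G (q + y) / 2)) > c"
    unfolding isCont_def by (rule order_tendstoD) (use pq in \<open>simp add: c_def\<close>)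
  then obtain L0 where L0: "L0 > 0"
    "\<And>y. y \<noteq> 0 \<Longrightarrow> \<bar>y\<bar> < L0 \<Longrightarrow> norm (cis (G (p + y) / 2) - cis (G (q + y) / 2)) > c"
    by (auto simp: eventually_at dist_real_def)
  define L where "L = L0 / 2"
  have L: "L > 0" "\<And>y. \<bar>y\<bar> \<le> L \<Longrightarrow> norm (cis (G (p + y) / 2) - cis (G (q + y) / 2)) \<ge> c"
  proof -
    show "L > 0" using L0 by (simp add: L_def)
    show "norm (cis (G (p + y) / 2) - cis (G (q + y) / 2)) \<ge> c" if "\<bar>y\<bar> \<le> L" for y
      using L0(2)[of y] that L0(1) by (cases "y = 0") (auto simp: L_def c_def)
  qed
  show thesis
  proof
    show "L > 0" by fact
    show "\<exists>S. \<forall>s\<le>S. K (s + L) - K (s - L) \<le> e" if "e > 0" for e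
    proof -
      from that \<open>c > 0\<close> have "e * c\<^sup>2 > 0" by simp
      then obtain T where T: "\<And>s s'. s \<ge> T \<Longrightarrow> s' \<ge> T \<Longrightarrow>
        (\<integral>\<^sup>+u. ennreal ((g u)\<^sup>2 * (norm (cis (G (u + s) / 2) - cis (G (u + s') / 2)))\<^sup>2) \<partial>lborel)
         \<le> ennreal (e * c\<^sup>2)"
        using C unfolding Cauchy_correlation_def mult_1 by blast
      \<comment> \<open>The shifts \<open>p - s\<close> and \<open>q - s\<close> are both at least
        \<open>T\<close> for such \<open>s\<close>, and they carry a point \<open>s + y\<close> to
        \<open>p + y\<close> and \<open>q + y\<close>.\<close>
      have "K (s + L) - K (s - L) \<le> e" if s: "s \<le> min p q - T" for s
      proof -
        have "K (s + L) * c\<^sup>2 - K (s - L) * c\<^sup>2 \<le> e * c\<^sup>2"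
        proof (rule nn_integral_ge_on_interval[where K = "\<lambda>x. K x * c\<^sup>2" and k = "\<lambda>x. (g x)\<^sup>2 * c\<^sup>2"])
          show "((\<lambda>x. K x * c\<^sup>2) has_real_derivative (g x)\<^sup>2 * c\<^sup>2) (at x)" for x
            by (intro DERIV_cmult_right K)
          show "(\<lambda>x. (g x)\<^sup>2 * c\<^sup>2) \<in> borel_measurable borel"
            by (intro borel_measurable_continuous_onI continuous_intros g)
          show "(\<integral>\<^sup>+u. ennreal ((g u)\<^sup>2 * (norm (cis (G (u + (p - s)) / 2) - cis (G (u + (q - s)) / 2)))\<^sup>2) \<partial>lborel)
             \<le> ennreal (e * c\<^sup>2)"
            using s by (intro T) auto
          show "(g x)\<^sup>2 * c\<^sup>2 \<le> (g x)\<^sup>2 * (norm (cis (G (x + (p - s)) / 2) - cis (G (x + (q - s)) / 2)))\<^sup>2"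
            if "s - L \<le> x" "x \<le> s + L" for x
          proof -
            have "\<bar>x - s\<bar> \<le> L" using that by (simp add: abs_le_iff)
            from L(2)[OF this] have "c \<le> norm (cis (G (x + (p - s)) / 2) - cis (G (x + (q - s)) / 2))"
              by (simp add: algebra_simps)
            then show ?thesis using \<open>c > 0\<close> by (intro mult_left_mono power_mono) auto
          qed
        qed (use L \<open>e * c\<^sup>2 > 0\<close> in auto)
        then show ?thesis using \<open>c > 0\<close> by (simp flip: left_diff_distrib)
      qed
      then show ?thesis by blast
    qed
  qed
qed

text \<open>This is the integrated form of
  \<open>\<bar>g x\<bar> \<le> (d + (g x)\<^sup>2 / d) / 2\<close>, obtained by monotonicity. With
  the weight \<open>d\<close> free, energy of order \<open>d\<^sup>2\<close> forces an increment of
  order \<open>d\<close> over a bounded interval.\<close>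

lemma increment_le_energy:
  assumes G: "\<And>x. (G has_real_derivative g x) (at x)"
    and K: "\<And>x. (K has_real_derivative (g x)\<^sup>2) (at x)"
    and "a \<le> b" "d > 0"
  shows "\<bar>G b - G a\<bar> \<le> (d * (b - a) + (K b - K a) / d) / 2"
proof -
  have amgm: "\<bar>g x\<bar> \<le> (d + (g x)\<^sup>2 / d) / 2" for x
  proof -
    have "0 \<le> (\<bar>g x\<bar> - d)\<^sup>2" by simp
    then have "2 * d * \<bar>g x\<bar> \<le> d\<^sup>2 + (g x)\<^sup>2" by (simp add: power2_diff algebra_simps)
    then show ?thesis using \<open>d > 0\<close> by (simp add: field_simps power2_eq_square)
  qed
  have "\<sigma> * G b - (d * b + K b / d) / 2 \<le> \<sigma> * G a - (d * a + K a / d) / 2" if "\<bar>\<sigma>\<bar> = 1" for \<sigma>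
  proof (rule DERIV_nonpos_imp_nonincreasing[OF \<open>a \<le> b\<close>, where f = "\<lambda>x. \<sigma> * G x - (d * x + K x / d) / 2"])
    fix x
    have "((\<lambda>x. \<sigma> * G x - (d * x + K x / d) / 2) has_real_derivative \<sigma> * g x - (d + (g x)\<^sup>2 / d) / 2) (at x)"
      using \<open>d > 0\<close> by (auto intro!: derivative_eq_intros G K)
    moreover have "\<sigma> * g x - (d + (g x)\<^sup>2 / d) / 2 \<le> 0"
    proof -
      have "\<sigma> * g x \<le> \<bar>g x\<bar>" using that by (metis abs_ge_self abs_mult mult_1)
      with amgm[of x] show ?thesis by simp
    qed
    ultimately show "\<exists>y. ((\<lambda>x. \<sigma> * G x - (d * x + K x / d) / 2) has_real_derivative y) (at x) \<and> y \<le> 0"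
      by blast
  qed
  from this[of 1] this[of "-1"] show ?thesis
    by (simp add: abs_le_iff diff_divide_distrib add_divide_distrib algebra_simps)
qed

text \<open>The correlation with sign 1 makes the energy, and hence the oscillation of
  \<open>G\<close>, small on windows near minus infinity. The correlation with sign -1, restricted
  to a neighbourhood of a point where \<open>g\<close> is nonzero, compares two such windows and
  makes the phase Cauchy. If \<open>g\<close> vanishes identically, \<open>G\<close> is
  constant.\<close>

lemma Cauchy_correlation_imp_limit_at_bot:
  assumes G: "\<And>x. (G has_real_derivative g x) (at x)" and g: "continuous_on UNIV g"
    and Cp: "Cauchy_correlation g G 1" and Cm: "Cauchy_correlation g G (- 1)"
  shows "\<exists>l. (G \<longlongrightarrow> l) at_bot"
proof (cases "\<exists>z. g z \<noteq> 0")
  case False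
  then have "(G has_real_derivative 0) (at x)" for x using G[of x] by simp
  then have "G x = G 0" for x using DERIV_isconst_all by blast
  then have "G = (\<lambda>x. G 0)" by auto
  then show ?thesis by (metis tendsto_const)
next
  case True
  then obtain z where z: "g z \<noteq> 0" by blast
  have cG: "continuous_on UNIV G"
    using G by (auto intro: continuous_at_imp_continuous_on DERIV_isCont)
  \<comment> \<open>A primitive of the energy density on the whole line expresses the energy of
    every window as an increment of \<open>K\<close>.\<close>
  have "\<exists>K. \<forall>x. - \<infinity> < ereal x \<longrightarrow> ereal x < \<infinity> \<longrightarrow> (K has_vector_derivative (g x)\<^sup>2) (at x)"
    by (rule einterval_antiderivative)
      (use g in \<open>auto simp: continuous_on_eq_continuous_at intro!: continuous_intros\<close>)
  then obtain K where K: "\<And>x. (K has_real_derivative (g x)\<^sup>2) (at x)"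
    by (auto simp: has_real_derivative_iff_has_vector_derivative)
  then have Kmono: "K a \<le> K b" if "a \<le> b" for a b
    using DERIV_nonneg_imp_nondecreasing[OF that] by (meson zero_le_power2)
  obtain L where L: "L > 0" "\<And>e. e > 0 \<Longrightarrow> \<exists>S. \<forall>s\<le>S. K (s + L) - K (s - L) \<le> e"
    using window_energy_at_bot[OF G g K Cp z] by blast
  have osc: "\<exists>S. \<forall>s\<le>S. \<forall>y. \<bar>y\<bar> \<le> L \<longrightarrow> \<bar>G (s + y) - G s\<bar> \<le> e" if "e > 0" for e
  proof -
    \<comment> \<open>With window energy at most \<open>d\<^sup>2\<close> the increment bound
      becomes \<open>(d * L + d) / 2\<close>, which is \<open>e / 2\<close>.\<close>
    define d where "d = e / (L + 1)"
    have d: "d > 0" "d * (L + 1) = e" using \<open>L > 0\<close> \<open>e > 0\<close> by (auto simp: d_def field_simps)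
    then obtain S where S: "\<forall>s\<le>S. K (s + L) - K (s - L) \<le> d\<^sup>2" using L(2)[of "d\<^sup>2"] by auto
    have "\<bar>G (s + y) - G s\<bar> \<le> e" if "s \<le> S" "\<bar>y\<bar> \<le> L" for s y
    proof -
      define a where "a = min s (s + y)"
      define b where "b = max s (s + y)"
      have ab: "a \<le> b" "b - a \<le> L" "s - L \<le> a" "b \<le> s + L"
        using that \<open>L > 0\<close> by (auto simp: a_def b_def)
      have "K b - K a \<le> d\<^sup>2" using Kmono[OF ab(3)] Kmono[OF ab(4)] S that by force
      then have "(K b - K a) / d \<le> d" using d by (simp add: field_simps power2_eq_square)
      moreover have "d * (b - a) \<le> d * L" using ab d by simp
      ultimately have "(d * (b - a) + (K b - K a) / d) / 2 \<le> (d * L + d) / 2"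
        by (intro divide_right_mono add_mono) auto
      with increment_le_energy[OF G K \<open>a \<le> b\<close> \<open>d > 0\<close>]
      have "\<bar>G b - G a\<bar> \<le> (d * L + d) / 2" by (rule order_trans)
      moreover have "\<bar>G (s + y) - G s\<bar> = \<bar>G b - G a\<bar>" by (auto simp: a_def b_def min_def max_def)
      ultimately have "\<bar>G (s + y) - G s\<bar> \<le> (d * L + d) / 2" by simp
      also have "\<dots> \<le> e" using d \<open>e > 0\<close> by (simp add: algebra_simps)
      finally show ?thesis .
    qed
    then show ?thesis by blast
  qed
  define c where "c = \<bar>g z\<bar> / 2"
  have "c > 0" using z by (simp add: c_def)
  have "isCont (\<lambda>x. \<bar>g x\<bar>) z" using g by (auto simp: continuous_on_eq_continuous_at intro!: continuous_intros)
  then have "\<forall>\<^sub>F x in at z. \<bar>g x\<bar> > c"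
    unfolding isCont_def by (rule order_tendstoD) (use z in \<open>simp add: c_def\<close>)
  then obtain l0 where l0: "l0 > 0" "\<And>x. x \<noteq> z \<Longrightarrow> \<bar>x - z\<bar> < l0 \<Longrightarrow> \<bar>g x\<bar> > c"
    by (auto simp: eventually_at dist_real_def)
  \<comment> \<open>On this radius both the lower bound for \<open>g\<close> near \<open>z\<close>
    and the oscillation bound for \<open>G\<close> are available.\<close>
  define l where "l = min L (l0 / 2)"
  have l: "l > 0" "l \<le> L" using l0 L by (auto simp: l_def)
  have gc: "\<bar>g x\<bar> \<ge> c" if "\<bar>x - z\<bar> \<le> l" for x
    using l0(2)[of x] that l0(1) by (cases "x = z") (auto simp: l_def c_def)
  have "\<exists>S. \<forall>a\<le>S. \<forall>b\<le>S. norm (cis (G a / 2) - cis (G b / 2)) \<le> e" if "e > 0" for e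
  proof -
    obtain S1 where S1: "\<And>s y. s \<le> S1 \<Longrightarrow> \<bar>y\<bar> \<le> L \<Longrightarrow> \<bar>G (s + y) - G s\<bar> \<le> e / 2"
      using osc[of "e / 2"] \<open>e > 0\<close> by auto
    \<comment> \<open>\<open>k\<close> is the pointwise lower bound for the integrand on a window of
      length \<open>2 * l\<close> should the claim fail. The integral would then be at least
      \<open>2 * k * l\<close>, against the bound \<open>k * l\<close>.\<close>
    define k where "k = c\<^sup>2 * (e / 2)\<^sup>2"
    have "k > 0" using \<open>c > 0\<close> \<open>e > 0\<close> by (simp add: k_def)
    with l have "k * l > 0" by simp
    then obtain T where T: "\<And>s s'. s \<ge> T \<Longrightarrow> s' \<ge> T \<Longrightarrow>
      (\<integral>\<^sup>+u. ennreal ((g u)\<^sup>2 * (norm (cis (G (u - s) / 2) - cis (G (u - s') / 2)))\<^sup>2) \<partial>lborel)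
       \<le> ennreal (k * l)"
      using Cm unfolding Cauchy_correlation_def by fastforce
    \<comment> \<open>The shifts \<open>z - a\<close> and \<open>z - b\<close> are at least
      \<open>T\<close> and move the window around \<open>z\<close> to windows around
      \<open>a\<close> and \<open>b\<close>.\<close>
    have "norm (cis (G a / 2) - cis (G b / 2)) \<le> e" if a: "a \<le> min S1 (z - T)" and b: "b \<le> min S1 (z - T)" for a b
    proof (rule ccontr)
      assume neg: "\<not> norm (cis (G a / 2) - cis (G b / 2)) \<le> e"
      \<comment> \<open>An oscillation \<open>e / 2\<close> of \<open>G\<close> is an oscillation
        \<open>e / 4\<close> of the half angle, so the two windows together lose at most
        \<open>e / 2\<close> of the distance \<open>e\<close>.\<close>
      have low: "norm (cis (G (a + y) / 2) - cis (G (b + y) / 2)) \<ge> e / 2" if "\<bar>y\<bar> \<le> l" for y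
      proof -
        have "norm (cis (G (a + y) / 2) - cis (G a / 2)) \<le> e / 4"
          using norm_cis_diff_le[of "G (a + y) / 2" "G a / 2"] S1[of a y] a that l
          by (simp flip: diff_divide_distrib)
        moreover have "norm (cis (G (b + y) / 2) - cis (G b / 2)) \<le> e / 4"
          using norm_cis_diff_le[of "G (b + y) / 2" "G b / 2"] S1[of b y] b that l
          by (simp flip: diff_divide_distrib)
        moreover have "norm (cis (G a / 2) - cis (G b / 2)) \<le> norm (cis (G (a + y) / 2) - cis (G (b + y) / 2))
            + norm (cis (G (a + y) / 2) - cis (G a / 2)) + norm (cis (G (b + y) / 2) - cis (G b / 2))"
          by norm
        ultimately show ?thesis using neg by simp
      qed
      have "k * (z + l) - k * (z - l) \<le> k * l"
      proof (rule nn_integral_ge_on_interval[where K = "\<lambda>x. k * x" and k = "\<lambda>x. k"])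
        show "((\<lambda>x. k * x) has_real_derivative k) (at x)" for x
          by (auto intro!: derivative_eq_intros)
        show "(\<integral>\<^sup>+u. ennreal ((g u)\<^sup>2 * (norm (cis (G (u - (z - a)) / 2) - cis (G (u - (z - b)) / 2)))\<^sup>2) \<partial>lborel)
           \<le> ennreal (k * l)"
          using a b by (intro T) auto
        show "k \<le> (g x)\<^sup>2 * (norm (cis (G (x - (z - a)) / 2) - cis (G (x - (z - b)) / 2)))\<^sup>2"
          if "z - l \<le> x" "x \<le> z + l" for x
        proof -
          have x: "\<bar>x - z\<bar> \<le> l" using that by (simp add: abs_le_iff)
          have "e / 2 \<le> norm (cis (G (x - (z - a)) / 2) - cis (G (x - (z - b)) / 2))"
            using low[OF x] by (simp add: algebra_simps)
          moreover have "c\<^sup>2 \<le> (g x)\<^sup>2" using power_mono[OF gc[OF x], of 2] \<open>c > 0\<close> by simp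
          ultimately show ?thesis using \<open>e > 0\<close> unfolding k_def by (intro mult_mono[OF _ power_mono]) auto
        qed
      qed (use l \<open>k > 0\<close> in auto)
      then show False using \<open>k * l > 0\<close> by (simp add: algebra_simps)
    qed
    then show ?thesis by blast
  qed
  from Cauchy_at_bot_convergent[OF Cauchy_phase_imp_Cauchy[OF cG this]] show ?thesis by blast
qed

text \<open>The substitution of \<open>- u\<close> for \<open>u\<close> reverses the translation.
  The primitive of the reflected function is \<open>- G (- x)\<close>, whose phase is conjugated,
  and conjugation preserves distances.\<close>

lemma Cauchy_correlation_reflect:
  assumes "Cauchy_correlation g G \<sigma>" "continuous_on UNIV g" "continuous_on UNIV G"
  shows "Cauchy_correlation (\<lambda>x. g (- x)) (\<lambda>x. - G (- x)) (- \<sigma>)"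
proof -
  have "(\<integral>\<^sup>+u. ennreal ((g (- u))\<^sup>2 * (norm (cis (- G (- (u + - \<sigma> * s)) / 2) - cis (- G (- (u + - \<sigma> * s')) / 2)))\<^sup>2) \<partial>lborel)
     = (\<integral>\<^sup>+u. ennreal ((g u)\<^sup>2 * (norm (cis (G (u + \<sigma> * s) / 2) - cis (G (u + \<sigma> * s') / 2)))\<^sup>2) \<partial>lborel)"
    (is "?l = ?r") for s s'
  proof -
    have "(\<lambda>u. (g u)\<^sup>2 * (norm (cis (G (u + \<sigma> * s) / 2) - cis (G (u + \<sigma> * s') / 2)))\<^sup>2) \<in> borel_measurable borel"
      by (intro borel_measurable_continuous_onI continuous_intros assms continuous_on_compose2[OF assms(3)]) auto
    then have "?r = (\<integral>\<^sup>+u. ennreal ((g (- u))\<^sup>2 * (norm (cis (G (- u + \<sigma> * s) / 2) - cis (G (- u + \<sigma> * s') / 2)))\<^sup>2) \<partial>lborel)"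
      by (subst nn_integral_real_affine[where c = "-1" and t = 0]) (auto simp: one_ennreal_def[symmetric])
    moreover have "norm (cis (- a) - cis (- b)) = norm (cis a - cis b)" for a b
      by (metis cis_cnj complex_cnj_diff complex_mod_cnj)
    ultimately show ?thesis by simp
  qed
  with assms(1) show ?thesis unfolding Cauchy_correlation_def by presburger
qed

lemma Cauchy_correlation_imp_limits:
  assumes G: "\<And>x. (G has_real_derivative g x) (at x)" and g: "continuous_on UNIV g"
    and C: "Cauchy_correlation g G 1" "Cauchy_correlation g G (- 1)"
  shows "(\<exists>l. (G \<longlongrightarrow> l) at_top) \<and> (\<exists>l. (G \<longlongrightarrow> l) at_bot)"
proof
  show "\<exists>l. (G \<longlongrightarrow> l) at_bot"
    by (rule Cauchy_correlation_imp_limit_at_bot[OF G g C])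
  have cG: "continuous_on UNIV G"
    using G by (auto intro: continuous_at_imp_continuous_on DERIV_isCont)
  have "\<exists>l. ((\<lambda>x. - G (- x)) \<longlongrightarrow> l) at_bot"
  proof (rule Cauchy_correlation_imp_limit_at_bot)
    show "((\<lambda>x. - G (- x)) has_real_derivative g (- x)) (at x)" for x
      by (rule derivative_eq_intros DERIV_chain2[OF G] refl | simp)+
    show "continuous_on UNIV (\<lambda>x. g (- x))"
      by (intro continuous_intros continuous_on_compose2[OF g]) auto
    show "Cauchy_correlation (\<lambda>x. g (- x)) (\<lambda>x. - G (- x)) 1"
      "Cauchy_correlation (\<lambda>x. g (- x)) (\<lambda>x. - G (- x)) (- 1)"
      using Cauchy_correlation_reflect[OF C(1) g cG] Cauchy_correlation_reflect[OF C(2) g cG] by simp_all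
  qed
  then obtain l where "((\<lambda>x. - G (- x)) \<longlongrightarrow> l) at_bot" ..
  from tendsto_minus[OF this] have "(G \<longlongrightarrow> - l) at_top"
    by (simp add: filterlim_at_bot_mirror)
  then show "\<exists>l. (G \<longlongrightarrow> l) at_top" ..
qed

section \<open>Scattering\<close>

text \<open>Local integrability makes each truncation of \<open>f'\<close> to a bounded interval
  measurable, and \<open>f'\<close> is their pointwise limit.\<close>

lemma has_ac_derivative_measurable:
  assumes "has_ac_derivative f f'"
  shows "f' \<in> borel_measurable borel"
proof (rule borel_measurable_LIMSEQ_metric)
  show "(\<lambda>x. indicator {- real n..real n} x *\<^sub>R f' x) \<in> borel_measurable borel" for n
  proof -
    have "set_integrable lborel {- real n..real n} f'"
      using assms by (simp add: has_ac_derivative_def)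
    then show ?thesis
      unfolding set_integrable_def using borel_measurable_integrable by fastforce
  qed
  fix x :: real
  obtain N where N: "\<bar>x\<bar> \<le> real N" using real_arch_simple by blast
  have "\<forall>\<^sub>F n in sequentially. indicator {- real n..real n} x *\<^sub>R f' x = f' x"
    using eventually_ge_at_top[of N] by eventually_elim (use N in \<open>auto simp: indicator_def abs_le_iff\<close>)
  then show "(\<lambda>n. indicator {- real n..real n} x *\<^sub>R f' x) \<longlonglongrightarrow> f' x"
    by (rule tendsto_eventually)
qed

lemma has_ac_derivativeI:
  assumes "\<And>x. (f has_vector_derivative f' x) (at x)" "continuous_on UNIV f'"
  shows "has_ac_derivative f f'"
  unfolding has_ac_derivative_def
proof (intro allI impI conjI)
  fix a b :: real assume "a \<le> b"
  have c: "continuous_on {a..b} f'" using assms(2) continuous_on_subset by blast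
  then show "set_integrable lborel {a..b} f'" by (rule borel_integrable_atLeastAtMost')
  show "f b - f a = (LINT y:{a..b}|lborel. f' y)"
    unfolding set_lebesgue_integral_def
    using integral_FTC_atLeastAtMost[OF \<open>a \<le> b\<close> _ c, of f] assms(1)
    by (metis has_vector_derivative_at_within)
qed

section \<open>Splitting of the error and the scattering criterion\<close>

lemma nn_integral_lborel_translate:
  fixes f :: "real \<Rightarrow> ennreal"
  assumes "f \<in> borel_measurable borel"
  shows "(\<integral>\<^sup>+x. f (x + t) \<partial>lborel) = (\<integral>\<^sup>+x. f x \<partial>lborel)"
  using nn_integral_real_affine[OF assms, of 1 t] by (simp add: add.commute one_ennreal_def[symmetric])

lemma norm_parallelogram_null:
  fixes a b p q :: complex
  shows "(norm (a + b - (p + q)))\<^sup>2 + (norm (a - b - (p - q)))\<^sup>2 = 2 * (norm (a - p))\<^sup>2 + 2 * (norm (b - q))\<^sup>2"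
  unfolding cmod_power2 by (simp add: power2_eq_square algebra_simps)

text \<open>The errors in \<open>x\<close> and in \<open>t\<close> are the sum and the difference of
  the two null errors, so the parallelogram law decouples them. Translating each integral by
  \<open>t\<close> or \<open>- t\<close> freezes its free profile and leaves the other factor
  shifted by \<open>2 * t\<close>.\<close>

lemma null_error_split:
  fixes A A' B B' p q :: "real \<Rightarrow> complex"
  assumes [measurable]: "A \<in> borel_measurable borel" "A' \<in> borel_measurable borel"
    "B \<in> borel_measurable borel" "B' \<in> borel_measurable borel"
    "p \<in> borel_measurable borel" "q \<in> borel_measurable borel"
  shows "(\<integral>\<^sup>+x. ennreal
      ((norm (A' (x + t) * B (x - t) + A (x + t) * B' (x - t) - (p (x + t) + q (x - t))))\<^sup>2 +
       (norm (A' (x + t) * B (x - t) - A (x + t) * B' (x - t) - (p (x + t) - q (x - t))))\<^sup>2) \<partial>lborel) =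
    2 * (\<integral>\<^sup>+u. ennreal ((norm (A' u * B (u - 2 * t) - p u))\<^sup>2) \<partial>lborel) +
    2 * (\<integral>\<^sup>+v. ennreal ((norm (B' v * A (v + 2 * t) - q v))\<^sup>2) \<partial>lborel)"
proof -
  have Q: "(\<integral>\<^sup>+x. ennreal ((norm (A' (x + t) * B (x - t) - p (x + t)))\<^sup>2) \<partial>lborel) =
      (\<integral>\<^sup>+u. ennreal ((norm (A' u * B (u - 2 * t) - p u))\<^sup>2) \<partial>lborel)"
    using nn_integral_lborel_translate[of "\<lambda>u. ennreal ((norm (A' u * B (u - 2 * t) - p u))\<^sup>2)" t]
    by (simp add: algebra_simps)
  have R: "(\<integral>\<^sup>+x. ennreal ((norm (B' (x - t) * A (x + t) - q (x - t)))\<^sup>2) \<partial>lborel) =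
      (\<integral>\<^sup>+v. ennreal ((norm (B' v * A (v + 2 * t) - q v))\<^sup>2) \<partial>lborel)"
    using nn_integral_lborel_translate[of "\<lambda>v. ennreal ((norm (B' v * A (v + 2 * t) - q v))\<^sup>2)" "- t"]
    by (simp add: algebra_simps)
  show ?thesis
    unfolding norm_parallelogram_null Q[symmetric] R[symmetric]
    by (simp add: ennreal_plus ennreal_mult nn_integral_add nn_integral_cmult mult.commute[of "A _" "B' _"])
qed

text \<open>Two profiles close to the same \<open>p\<close> are close to each other. Only
  differences are integrated, so no infinite norms are subtracted.\<close>

lemma correlation_Cauchy:
  fixes w Z p :: "real \<Rightarrow> complex"
  assumes [measurable]: "w \<in> borel_measurable borel" "Z \<in> borel_measurable borel" "p \<in> borel_measurable borel"
    and lim: "((\<lambda>t. \<integral>\<^sup>+u. ennreal ((norm (w u * Z (u + \<sigma> * (2 * t)) - p u))\<^sup>2) \<partial>lborel) \<longlongrightarrow> 0) at_top"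
    and "e > 0"
  shows "\<exists>T. \<forall>s\<ge>T. \<forall>s'\<ge>T.
    (\<integral>\<^sup>+u. ennreal ((norm (w u))\<^sup>2 * (norm (Z (u + \<sigma> * s) - Z (u + \<sigma> * s')))\<^sup>2) \<partial>lborel) \<le> ennreal e"
proof -
  let ?J = "\<lambda>s. \<integral>\<^sup>+u. ennreal ((norm (w u * Z (u + \<sigma> * s) - p u))\<^sup>2) \<partial>lborel"
  have "\<forall>\<^sub>F t in at_top. ?J (2 * t) < ennreal (e / 4)"
    using order_tendstoD(2)[OF lim, of "ennreal (e / 4)"] \<open>e > 0\<close> by simp
  then obtain T where T: "\<And>t. t \<ge> T \<Longrightarrow> ?J (2 * t) < ennreal (e / 4)"
    by (auto simp: eventually_at_top_linorder)
  \<comment> \<open>The shift is twice the time, so shift \<open>s\<close> belongs to time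
    \<open>s / 2\<close>. Four terms \<open>e / 4\<close> add up to \<open>e\<close> below.\<close>
  have J: "?J s \<le> ennreal (e / 4)" if "s \<ge> 2 * T" for s
    using T[of "s / 2"] that by simp
  have "(\<integral>\<^sup>+u. ennreal ((norm (w u))\<^sup>2 * (norm (Z (u + \<sigma> * s) - Z (u + \<sigma> * s')))\<^sup>2) \<partial>lborel) \<le> ennreal e"
    if "s \<ge> 2 * T" "s' \<ge> 2 * T" for s s'
  proof -
    have "(norm (w u))\<^sup>2 * (norm (Z (u + \<sigma> * s) - Z (u + \<sigma> * s')))\<^sup>2 \<le>
       2 * (norm (w u * Z (u + \<sigma> * s) - p u))\<^sup>2 + 2 * (norm (w u * Z (u + \<sigma> * s') - p u))\<^sup>2" for u
    proof -
      have sq: "(norm (x - y))\<^sup>2 \<le> 2 * (norm x)\<^sup>2 + 2 * (norm y)\<^sup>2" for x y :: complex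
      proof -
        have "(norm (x - y))\<^sup>2 \<le> (norm x + norm y)\<^sup>2"
          by (intro power_mono norm_triangle_ineq4) auto
        also have "\<dots> \<le> 2 * (norm x)\<^sup>2 + 2 * (norm y)\<^sup>2"
          using zero_le_power2[of "norm x - norm y"] by (simp add: power2_eq_square algebra_simps)
        finally show ?thesis .
      qed
      have "(norm (w u))\<^sup>2 * (norm (Z (u + \<sigma> * s) - Z (u + \<sigma> * s')))\<^sup>2 =
         (norm ((w u * Z (u + \<sigma> * s) - p u) - (w u * Z (u + \<sigma> * s') - p u)))\<^sup>2"
        by (simp add: norm_mult power_mult_distrib flip: right_diff_distrib)
      also have "\<dots> \<le> 2 * (norm (w u * Z (u + \<sigma> * s) - p u))\<^sup>2 + 2 * (norm (w u * Z (u + \<sigma> * s') - p u))\<^sup>2"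
        by (rule sq)
      finally show ?thesis .
    qed
    then have "(\<integral>\<^sup>+u. ennreal ((norm (w u))\<^sup>2 * (norm (Z (u + \<sigma> * s) - Z (u + \<sigma> * s')))\<^sup>2) \<partial>lborel) \<le>
      (\<integral>\<^sup>+u. ennreal (2 * (norm (w u * Z (u + \<sigma> * s) - p u))\<^sup>2 + 2 * (norm (w u * Z (u + \<sigma> * s') - p u))\<^sup>2) \<partial>lborel)"
      by (intro nn_integral_mono ennreal_leI)
    also have "\<dots> = 2 * ?J s + 2 * ?J s'"
      by (simp add: ennreal_plus ennreal_mult nn_integral_add nn_integral_cmult)
    also have "\<dots> \<le> 2 * ennreal (e / 4) + 2 * ennreal (e / 4)"
      by (intro add_mono mult_left_mono J that) auto
    also have "\<dots> = ennreal (2 * (e / 4) + 2 * (e / 4))"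
      using \<open>e > 0\<close> unfolding mult_2 by (simp flip: ennreal_plus)
    finally show ?thesis by simp
  qed
  then show ?thesis by blast
qed

text \<open>Dominated convergence along arbitrary sequences tending to infinity, with majorant four
  times the squared norm of \<open>w\<close>, because \<open>Z\<close> and \<open>c\<close> lie in
  the unit disc.\<close>

lemma correlation_tendsto:
  fixes w Z :: "real \<Rightarrow> complex"
  assumes [measurable]: "w \<in> borel_measurable borel" "Z \<in> borel_measurable borel"
    and fin: "(\<integral>\<^sup>+u. ennreal ((norm (w u))\<^sup>2) \<partial>lborel) < \<infinity>"
    and lim: "\<And>u. ((\<lambda>t. Z (u + \<sigma> * (2 * t))) \<longlongrightarrow> c) at_top"
    and bound: "\<And>u. norm (Z u) \<le> 1" "norm c \<le> 1"
  shows "((\<lambda>t. \<integral>\<^sup>+u. ennreal ((norm (w u * Z (u + \<sigma> * (2 * t)) - w u * c))\<^sup>2) \<partial>lborel) \<longlongrightarrow> 0) at_top"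
proof (rule tendsto_at_topI_sequentially)
  fix X :: "nat \<Rightarrow> real" assume X: "filterlim X at_top sequentially"
  have "(\<lambda>n. \<integral>\<^sup>+u. ennreal ((norm (w u * Z (u + \<sigma> * (2 * X n)) - w u * c))\<^sup>2) \<partial>lborel)
     \<longlonglongrightarrow> integral\<^sup>N lborel (\<lambda>_::real. 0)"
  proof (rule nn_integral_dominated_convergence[where u' = "\<lambda>_. 0" and w = "\<lambda>u. 4 * ennreal ((norm (w u))\<^sup>2)"])
    show "AE u in lborel. ennreal ((norm (w u * Z (u + \<sigma> * (2 * X n)) - w u * c))\<^sup>2)
        \<le> 4 * ennreal ((norm (w u))\<^sup>2)" for n
    proof (rule AE_I2)
      fix u
      have "norm (w u * Z (u + \<sigma> * (2 * X n)) - w u * c) = norm (w u) * norm (Z (u + \<sigma> * (2 * X n)) - c)"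
        by (simp add: norm_mult flip: right_diff_distrib)
      also have "\<dots> \<le> norm (w u) * 2"
        using norm_triangle_ineq4[of "Z (u + \<sigma> * (2 * X n))" c] bound(1)[of "u + \<sigma> * (2 * X n)"] bound(2)
        by (intro mult_left_mono) auto
      finally have "(norm (w u * Z (u + \<sigma> * (2 * X n)) - w u * c))\<^sup>2 \<le> (norm (w u) * 2)\<^sup>2"
        by (intro power_mono) auto
      then have "ennreal ((norm (w u * Z (u + \<sigma> * (2 * X n)) - w u * c))\<^sup>2) \<le> ennreal (4 * (norm (w u))\<^sup>2)"
        by (intro ennreal_leI) (simp add: power_mult_distrib)
      then show "ennreal ((norm (w u * Z (u + \<sigma> * (2 * X n)) - w u * c))\<^sup>2) \<le> 4 * ennreal ((norm (w u))\<^sup>2)"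
        by (simp add: ennreal_mult)
    qed
    show "(\<integral>\<^sup>+u. 4 * ennreal ((norm (w u))\<^sup>2) \<partial>lborel) < \<infinity>"
      using fin by (simp add: nn_integral_cmult ennreal_mult_less_top)
    show "AE u in lborel. (\<lambda>n. ennreal ((norm (w u * Z (u + \<sigma> * (2 * X n)) - w u * c))\<^sup>2)) \<longlonglongrightarrow> 0"
    proof (rule AE_I2)
      fix u
      have "(\<lambda>n. Z (u + \<sigma> * (2 * X n))) \<longlonglongrightarrow> c"
        using filterlim_compose[OF lim X] .
      then have "(\<lambda>n. (norm (w u * Z (u + \<sigma> * (2 * X n)) - w u * c))\<^sup>2) \<longlonglongrightarrow> (norm (w u * c - w u * c))\<^sup>2"
        by (intro tendsto_intros)
      then show "(\<lambda>n. ennreal ((norm (w u * Z (u + \<sigma> * (2 * X n)) - w u * c))\<^sup>2)) \<longlonglongrightarrow> 0"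
        using tendsto_ennrealI by fastforce
    qed
  qed auto
  then show "(\<lambda>n. \<integral>\<^sup>+u. ennreal ((norm (w u * Z (u + \<sigma> * (2 * X n)) - w u * c))\<^sup>2) \<partial>lborel) \<longlonglongrightarrow> 0"
    by simp
qed

text \<open>The shifts are written with explicit factors \<open>- 1\<close> and \<open>1\<close> to
  match the sign \<sigma> in the correlation lemmas.\<close>

lemma phase_wave_error:
  assumes G: "\<And>x. (G has_real_derivative g x) (at x)" and g: "continuous_on UNIV g"
    and p: "p \<in> borel_measurable borel" and q: "q \<in> borel_measurable borel"
  defines "A \<equiv> \<lambda>x. cis (G x / 2)" and "B \<equiv> \<lambda>x. cis (- (G x / 2))"
  shows "(\<integral>\<^sup>+x. ennreal
      ((norm (Dx (phase_wave G) x t - (p (x + t) + q (x - t))))\<^sup>2 +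
       (norm (Dt (phase_wave G) x t - (p (x + t) - q (x - t))))\<^sup>2) \<partial>lborel) =
    2 * (\<integral>\<^sup>+u. ennreal ((norm (\<i> * (g u / 2) * A u * B (u + - 1 * (2 * t)) - p u))\<^sup>2) \<partial>lborel) +
    2 * (\<integral>\<^sup>+v. ennreal ((norm (- (\<i> * (g v / 2) * B v) * A (v + 1 * (2 * t)) - q v))\<^sup>2) \<partial>lborel)"
proof -
  have cG: "continuous_on UNIV G"
    using G by (auto intro: continuous_at_imp_continuous_on DERIV_isCont)
  have m: "A \<in> borel_measurable borel" "B \<in> borel_measurable borel"
    "(\<lambda>x. \<i> * (g x / 2) * A x) \<in> borel_measurable borel"
    "(\<lambda>x. - (\<i> * (g x / 2) * B x)) \<in> borel_measurable borel"
    unfolding A_def B_def by (intro borel_measurable_continuous_onI continuous_intros cG g; simp)+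
  show ?thesis
    using null_error_split[OF m(1,3,2,4) p q, of t]
    by (simp add: phase_wave_derivs(2,3)[OF G g] A_def B_def)
qed

text \<open>Both error terms are nonnegative, so each tends to zero on its own. The profile in
  \<open>u\<close> yields the correlation with sign -1, the profile in \<open>v\<close> the one with
  sign 1.\<close>

lemma phase_wave_scatters_imp_limits:
  assumes G: "\<And>x. (G has_real_derivative g x) (at x)" and g: "continuous_on UNIV g"
    and S: "approaches_free_wave (phase_wave G)"
  shows "(\<exists>l. (G \<longlongrightarrow> l) at_top) \<and> (\<exists>l. (G \<longlongrightarrow> l) at_bot)"
proof (rule Cauchy_correlation_imp_limits[OF G g])
  define A where "A x = cis (G x / 2)" for x
  define B where "B x = cis (- (G x / 2))" for x
  define A' where "A' x = \<i> * (g x / 2) * A x" for x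
  define B' where "B' x = - (\<i> * (g x / 2) * B x)" for x
  have cG: "continuous_on UNIV G"
    using G by (auto intro: continuous_at_imp_continuous_on DERIV_isCont)
  have m: "A \<in> borel_measurable borel" "B \<in> borel_measurable borel"
    "A' \<in> borel_measurable borel" "B' \<in> borel_measurable borel"
    unfolding A_def[abs_def] B_def[abs_def] A'_def[abs_def] B'_def[abs_def]
    by (intro borel_measurable_continuous_onI continuous_intros cG g; simp)+
  obtain fp fm p q where ac: "has_ac_derivative fp p" "has_ac_derivative fm q"
    and lim: "((\<lambda>t. \<integral>\<^sup>+ x. ennreal
               ((norm (Dx (phase_wave G) x t - (p (x + t) + q (x - t))))\<^sup>2 +
                (norm (Dt (phase_wave G) x t - (p (x + t) - q (x - t))))\<^sup>2) \<partial>lborel)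
          \<longlongrightarrow> 0) at_top"
    using S unfolding approaches_free_wave_def by blast
  note mp = ac[THEN has_ac_derivative_measurable]
  define J1 where "J1 t = (\<integral>\<^sup>+u. ennreal ((norm (A' u * B (u + - 1 * (2 * t)) - p u))\<^sup>2) \<partial>lborel)" for t
  define J2 where "J2 t = (\<integral>\<^sup>+v. ennreal ((norm (B' v * A (v + 1 * (2 * t)) - q v))\<^sup>2) \<partial>lborel)" for t
  have J: "((\<lambda>t. 2 * J1 t + 2 * J2 t) \<longlongrightarrow> 0) at_top"
    using lim unfolding phase_wave_error[OF G g mp] J1_def J2_def A'_def B'_def A_def B_def .
  have "J1 t \<le> 2 * J1 t + 2 * J2 t" "J2 t \<le> 2 * J1 t + 2 * J2 t" for t
    by (simp_all add: mult_2 add_increasing add_increasing2)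
  then have "(J1 \<longlongrightarrow> 0) at_top" "(J2 \<longlongrightarrow> 0) at_top"
    by (auto intro: tendsto_sandwich[OF _ _ tendsto_const J])
  note L = this[unfolded J1_def J2_def]
  have corr: "Cauchy_correlation g G \<sigma>"
    if w: "w \<in> borel_measurable borel" and Z: "Z \<in> borel_measurable borel" and p: "p \<in> borel_measurable borel"
      and lim: "((\<lambda>t. \<integral>\<^sup>+u. ennreal ((norm (w u * Z (u + \<sigma> * (2 * t)) - p u))\<^sup>2) \<partial>lborel) \<longlongrightarrow> 0) at_top"
      and nw: "\<And>u. norm (w u) = \<bar>g u\<bar> / 2"
      and nZ: "\<And>u v. norm (Z u - Z v) = norm (cis (G u / 2) - cis (G v / 2))" for w Z p :: "real \<Rightarrow> complex" and \<sigma>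
    unfolding Cauchy_correlation_def
  proof (intro allI impI)
    fix e :: real assume "e > 0"
    \<comment> \<open>The weight \<open>w\<close> has norm \<open>\<bar>g u\<bar> / 2\<close>;
      passing to \<open>g\<close> multiplies the integral by 4.\<close>
    then have "e / 4 > 0" by simp
    from correlation_Cauchy[OF w Z p lim this] obtain T where T: "\<And>s s'. s \<ge> T \<Longrightarrow> s' \<ge> T \<Longrightarrow>
      (\<integral>\<^sup>+u. ennreal ((norm (w u))\<^sup>2 * (norm (Z (u + \<sigma> * s) - Z (u + \<sigma> * s')))\<^sup>2) \<partial>lborel) \<le> ennreal (e / 4)"
      by blast
    have "(\<integral>\<^sup>+u. ennreal ((g u)\<^sup>2 * (norm (cis (G (u + \<sigma> * s) / 2) - cis (G (u + \<sigma> * s') / 2)))\<^sup>2) \<partial>lborel) \<le> ennreal e"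
      if "s \<ge> T" "s' \<ge> T" for s s'
    proof -
      have "ennreal ((g u)\<^sup>2 * (norm (cis (G (u + \<sigma> * s) / 2) - cis (G (u + \<sigma> * s') / 2)))\<^sup>2) =
        ennreal 4 * ennreal ((norm (w u))\<^sup>2 * (norm (Z (u + \<sigma> * s) - Z (u + \<sigma> * s')))\<^sup>2)" for u
        unfolding nw nZ by (subst ennreal_mult[symmetric]) (auto simp: power_divide)
      then have "(\<integral>\<^sup>+u. ennreal ((g u)\<^sup>2 * (norm (cis (G (u + \<sigma> * s) / 2) - cis (G (u + \<sigma> * s') / 2)))\<^sup>2) \<partial>lborel)
        = ennreal 4 * (\<integral>\<^sup>+u. ennreal ((norm (w u))\<^sup>2 * (norm (Z (u + \<sigma> * s) - Z (u + \<sigma> * s')))\<^sup>2) \<partial>lborel)"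
        using w Z by (simp add: nn_integral_cmult del: ennreal_numeral)
      also have "\<dots> \<le> ennreal 4 * ennreal (e / 4)"
        by (intro mult_left_mono T that) auto
      also have "\<dots> = ennreal e"
        using \<open>e > 0\<close> by (subst ennreal_mult[symmetric]) auto
      finally show ?thesis .
    qed
    then show "\<exists>T. \<forall>s\<ge>T. \<forall>s'\<ge>T. (\<integral>\<^sup>+u. ennreal ((g u)\<^sup>2 *
        (norm (cis (G (u + \<sigma> * s) / 2) - cis (G (u + \<sigma> * s') / 2)))\<^sup>2) \<partial>lborel) \<le> ennreal e" by blast
  qed
  have "norm (B u - B v) = norm (cis (G u / 2) - cis (G v / 2))" for u v
    unfolding B_def by (metis cis_cnj complex_cnj_diff complex_mod_cnj)
  then show "Cauchy_correlation g G (- 1)"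
    by (intro corr[OF m(3,2) mp(1) L(1)]) (auto simp: A'_def A_def norm_mult)
  show "Cauchy_correlation g G 1"
    by (intro corr[OF m(4,1) mp(2) L(2)]) (auto simp: A_def B'_def B_def norm_mult)
qed

text \<open>At fixed \<open>u\<close> the other factor is evaluated far to the left and tends to
  \<open>b\<close>; at fixed \<open>v\<close> it is evaluated far to the right and tends to
  \<open>a\<close>. The free wave is therefore \<open>A u * b + B v * a\<close>, and finite energy
  of \<open>g\<close> supplies the majorant.\<close>

lemma phase_wave_limits_imp_scatters:
  assumes G: "\<And>x. (G has_real_derivative g x) (at x)" and g: "continuous_on UNIV g"
    and L2: "L2 (\<lambda>x. \<i> * complex_of_real (g x))"
    and Gp: "(G \<longlongrightarrow> Gp) at_top" and Gm: "(G \<longlongrightarrow> Gm) at_bot"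
  shows "approaches_free_wave (phase_wave G)"
proof -
  define A where "A x = cis (G x / 2)" for x
  define B where "B x = cis (- (G x / 2))" for x
  define A' where "A' x = \<i> * (g x / 2) * A x" for x
  define B' where "B' x = - (\<i> * (g x / 2) * B x)" for x
  define a where "a = cis (Gp / 2)"
  define b where "b = cis (- (Gm / 2))"
  have cG: "continuous_on UNIV G"
    using G by (auto intro: continuous_at_imp_continuous_on DERIV_isCont)
  have c: "continuous_on UNIV A" "continuous_on UNIV B"
    "continuous_on UNIV A'" "continuous_on UNIV B'"
    unfolding A_def[abs_def] B_def[abs_def] A'_def[abs_def] B'_def[abs_def]
    by (intro continuous_intros cG g; simp)+
  note m = c[THEN borel_measurable_continuous_onI]
  have AB: "(A has_vector_derivative A' x) (at x)" "(B has_vector_derivative B' x) (at x)" for x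
    using has_vector_derivative_cis_half[OF G, of x] by (simp_all add: A_def[abs_def] B_def[abs_def] A'_def B'_def)
  have "has_ac_derivative (\<lambda>x. A x * b) (\<lambda>x. A' x * b)" "has_ac_derivative (\<lambda>x. B x * a) (\<lambda>x. B' x * a)"
    by (intro has_ac_derivativeI has_vector_derivative_mult_left AB continuous_intros c)+
  moreover have "((\<lambda>t. \<integral>\<^sup>+ x. ennreal
               ((norm (Dx (phase_wave G) x t - (A' (x + t) * b + B' (x - t) * a)))\<^sup>2 +
                (norm (Dt (phase_wave G) x t - (A' (x + t) * b - B' (x - t) * a)))\<^sup>2) \<partial>lborel)
          \<longlongrightarrow> 0) at_top"
  proof -
    have "integrable lborel (\<lambda>x. (g x)\<^sup>2)"
      using L2 by (simp add: L2_def norm_mult)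
    then have "integrable lborel (\<lambda>x. (g x)\<^sup>2 / 4)" by simp
    then have "(\<integral>\<^sup>+x. ennreal ((g x)\<^sup>2 / 4) \<partial>lborel) < \<infinity>"
      by (simp add: integrable_iff_bounded)
    moreover have "(norm (A' x))\<^sup>2 = (g x)\<^sup>2 / 4" "(norm (B' x))\<^sup>2 = (g x)\<^sup>2 / 4" for x
      by (simp_all add: A'_def B'_def A_def B_def norm_mult power_divide)
    ultimately have fin: "(\<integral>\<^sup>+x. ennreal ((norm (A' x))\<^sup>2) \<partial>lborel) < \<infinity>"
      "(\<integral>\<^sup>+x. ennreal ((norm (B' x))\<^sup>2) \<partial>lborel) < \<infinity>" by (simp_all only:)
    have AB_lim: "(B \<longlongrightarrow> b) at_bot" "(A \<longlongrightarrow> a) at_top"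
      unfolding A_def[abs_def] B_def[abs_def] a_def b_def by (intro tendsto_intros Gp Gm; simp)+
    have shift: "filterlim (\<lambda>t. u + - 1 * (2 * t)) at_bot at_top" "filterlim (\<lambda>t. u + 1 * (2 * t)) at_top at_top" for u :: real
    proof -
      have "filterlim (\<lambda>t::real. 2 * t) at_top at_top"
        by (rule filterlim_tendsto_pos_mult_at_top[OF tendsto_const _ filterlim_ident]) simp
      then have *: "filterlim (\<lambda>t. r + 2 * t) at_top at_top" for r :: real
        by (rule filterlim_tendsto_add_at_top[OF tendsto_const])
      show "filterlim (\<lambda>t. u + - 1 * (2 * t)) at_bot at_top"
        using *[of "- u"] by (simp add: filterlim_uminus_at_bot)
      show "filterlim (\<lambda>t. u + 1 * (2 * t)) at_top at_top"
        using *[of u] by simp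
    qed
    have lims: "((\<lambda>t. B (u + - 1 * (2 * t))) \<longlongrightarrow> b) at_top" "((\<lambda>t. A (u + 1 * (2 * t))) \<longlongrightarrow> a) at_top" for u
      by (rule filterlim_compose[OF AB_lim(1) shift(1)], rule filterlim_compose[OF AB_lim(2) shift(2)])
    have n: "norm (A x) \<le> 1" "norm (B x) \<le> 1" "norm a \<le> 1" "norm b \<le> 1" for x
      by (simp_all add: A_def B_def a_def b_def)
    have mm: "(\<lambda>x. A' x * b) \<in> borel_measurable borel" "(\<lambda>x. B' x * a) \<in> borel_measurable borel"
      by (intro borel_measurable_continuous_onI continuous_intros c)+
    have "((\<lambda>t. 2 * (\<integral>\<^sup>+u. ennreal ((norm (A' u * B (u + - 1 * (2 * t)) - A' u * b))\<^sup>2) \<partial>lborel) +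
        2 * (\<integral>\<^sup>+u. ennreal ((norm (B' u * A (u + 1 * (2 * t)) - B' u * a))\<^sup>2) \<partial>lborel)) \<longlongrightarrow> 2 * 0 + 2 * 0) at_top"
      by (intro tendsto_add tendsto_mult_ennreal tendsto_const
          correlation_tendsto[OF m(3,2) fin(1) lims(1) n(2,4)] correlation_tendsto[OF m(4,1) fin(2) lims(2) n(1,3)]) auto
    then show ?thesis
      unfolding phase_wave_error[OF G g mm, folded A_def B_def, folded A'_def B'_def] by simp
  qed
  ultimately show ?thesis unfolding approaches_free_wave_def by blast
qed

section \<open>Smooth data of finite energy that does not scatter\<close>

lemma smooth_rational:
  "smooth (\<lambda>x. poly p x / (1 + x\<^sup>2) ^ k)"
proof -
  have nz: "1 + x\<^sup>2 \<noteq> 0" for x :: real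
    by (metis add_pos_nonneg less_irrefl zero_le_power2 zero_less_one)
  \<comment> \<open>The family of quotients of a polynomial by a power of
    \<open>1 + x\<^sup>2\<close> is closed under differentiation, with the power raised by one. The
    induction on the order of the derivative therefore ranges over all \<open>p\<close> and
    \<open>k\<close>.\<close>
  have D: "((\<lambda>x. poly p x / (1 + x\<^sup>2) ^ k) has_real_derivative
      poly (pderiv p * [:1, 0, 1:] - smult (2 * real k) ([:0, 1:] * p)) x / (1 + x\<^sup>2) ^ Suc k) (at x)" for p k x
  proof -
    have "((\<lambda>x. poly p x / (1 + x\<^sup>2) ^ k) has_real_derivative
      (poly (pderiv p) x * (1 + x\<^sup>2) ^ k - poly p x * (real k * (2 * x) * (1 + x\<^sup>2) ^ (k - 1))) /
        ((1 + x\<^sup>2) ^ k * (1 + x\<^sup>2) ^ k)) (at x)"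
      using nz by (auto intro!: derivative_eq_intros poly_DERIV simp: algebra_simps)
    also have "(poly (pderiv p) x * (1 + x\<^sup>2) ^ k - poly p x * (real k * (2 * x) * (1 + x\<^sup>2) ^ (k - 1))) /
        ((1 + x\<^sup>2) ^ k * (1 + x\<^sup>2) ^ k) =
      poly (pderiv p * [:1, 0, 1:] - smult (2 * real k) ([:0, 1:] * p)) x / (1 + x\<^sup>2) ^ Suc k"
    proof -
      define y where "y = 1 + x\<^sup>2"
      have "y \<noteq> 0" using nz by (simp add: y_def)
      have y: "poly [:1, 0, 1:] x = y" by (simp add: y_def power2_eq_square)
      have "poly (pderiv p * [:1, 0, 1:] - smult (2 * real k) ([:0, 1:] * p)) x =
        poly (pderiv p) x * y - 2 * real k * (x * poly p x)"
        by (simp only: poly_diff poly_mult poly_smult y) simp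
      \<comment> \<open>At \<open>k = 0\<close> the truncated exponent \<open>k - 1\<close> does no
        harm, because it comes with the factor \<open>real k = 0\<close>.\<close>
      then show ?thesis
        unfolding y_def[symmetric] using \<open>y \<noteq> 0\<close> by (cases k) (simp_all add: field_simps)
    qed
    finally show ?thesis .
  qed
  have "(deriv ^^ n) (\<lambda>x. poly p x / (1 + x\<^sup>2) ^ k) differentiable (at x)" for n x
  proof (induction n arbitrary: p k)
    case 0
    show ?case using D by (auto intro: differentiableI simp: has_field_derivative_def differentiable_def)
  next
    case (Suc n)
    have "deriv (\<lambda>x. poly p x / (1 + x\<^sup>2) ^ k) =
      (\<lambda>x. poly (pderiv p * [:1, 0, 1:] - smult (2 * real k) ([:0, 1:] * p)) x / (1 + x\<^sup>2) ^ Suc k)"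
      using D DERIV_imp_deriv by blast
    then show ?case
      using Suc[of "pderiv p * [:1, 0, 1:] - smult (2 * real k) ([:0, 1:] * p)" "Suc k"]
      by (simp only: funpow_Suc_right o_apply)
  qed
  then show ?thesis by (simp add: smooth_def)
qed

lemma smooth_derivs:
  assumes "smooth g"
  shows "(g has_real_derivative deriv g x) (at x)" "continuous_on UNIV (deriv g)"
proof -
  have "(deriv ^^ 0) g differentiable (at x)" "(deriv ^^ 1) g differentiable (at x)" for x
    using assms unfolding smooth_def by blast+
  then have d: "g differentiable (at x)" "deriv g differentiable (at x)" for x by simp_all
  show "(g has_real_derivative deriv g x) (at x)"
    using d(1) DERIV_deriv_iff_real_differentiable by blast
  show "continuous_on UNIV (deriv g)"
    using d(2) by (intro continuous_at_imp_continuous_on ballI differentiable_imp_continuous_within)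
qed

text \<open>The square of \<open>x / (1 + x\<^sup>2)\<close> is at most
  \<open>1 / (1 + x\<^sup>2)\<close>, which is integrable.\<close>

lemma energy_data_slow_log:
  "energy_data (\<lambda>x. 1) (\<lambda>x. \<i> * complex_of_real (x / (1 + x\<^sup>2)))"
proof -
  have nz: "1 + x\<^sup>2 > 0" for x :: real by (simp add: add_pos_nonneg)
  then have nz': "1 + x\<^sup>2 \<noteq> 0" for x :: real by (metis less_irrefl)
  have c: "continuous_on UNIV (\<lambda>x::real. x / (1 + x\<^sup>2))"
    by (intro continuous_intros) (use nz' in auto)
  have ac: "has_ac_derivative (\<lambda>x. 1) (\<lambda>x. 0)"
    by (intro has_ac_derivativeI) auto
  have i: "integrable lborel (\<lambda>x::real. inverse (1 + x\<^sup>2))"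
    using integrable_inverse_1_plus_square by (simp add: set_integrable_def)
  have "integrable lborel (\<lambda>x::real. (x / (1 + x\<^sup>2))\<^sup>2)"
  proof (rule Bochner_Integration.integrable_bound[OF i])
    show "(\<lambda>x::real. (x / (1 + x\<^sup>2))\<^sup>2) \<in> borel_measurable lborel"
      using borel_measurable_continuous_onI[OF c] by measurable
    have "(x / (1 + x\<^sup>2))\<^sup>2 \<le> inverse (1 + x\<^sup>2)" for x :: real
    proof -
      have "(x / (1 + x\<^sup>2))\<^sup>2 \<le> (1 + x\<^sup>2) / (1 + x\<^sup>2)\<^sup>2"
        unfolding power_divide by (intro divide_right_mono) auto
      also have "\<dots> = inverse (1 + x\<^sup>2)"
        by (simp add: power2_eq_square[of "1 + x\<^sup>2"] inverse_eq_divide)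
      finally show ?thesis .
    qed
    then show "AE x::real in lborel. norm ((x / (1 + x\<^sup>2))\<^sup>2) \<le> norm (inverse (1 + x\<^sup>2))"
      using nz by (intro AE_I2) (simp add: less_imp_le)
  qed
  moreover have "(\<lambda>x. \<i> * complex_of_real (x / (1 + x\<^sup>2))) \<in> borel_measurable lborel"
    using borel_measurable_continuous_onI[OF c] by measurable
  ultimately have "L2 (\<lambda>x. \<i> * complex_of_real (x / (1 + x\<^sup>2)))"
    unfolding L2_def by (simp only: norm_mult norm_ii norm_of_real mult_1 power2_abs)
  moreover have "L2 (\<lambda>x. 0)" by (simp add: L2_def)
  ultimately show ?thesis using ac unfolding energy_data_def by blast
qed

lemma slow_log_deriv:
  "((\<lambda>x. ln (1 + x\<^sup>2) / 2) has_real_derivative x / (1 + x\<^sup>2)) (at (x::real))"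
proof -
  have "1 + x\<^sup>2 > 0" by (simp add: add_pos_nonneg)
  then show ?thesis by (auto intro!: derivative_eq_intros simp: field_simps)
qed

lemma slow_log_no_limit: "\<not> ((\<lambda>x::real. ln (1 + x\<^sup>2) / 2) \<longlongrightarrow> l) at_top"
proof
  assume "((\<lambda>x::real. ln (1 + x\<^sup>2) / 2) \<longlongrightarrow> l) at_top"
  from tendsto_mult[OF tendsto_const[of 2] this]
  have "((\<lambda>x::real. ln (1 + x\<^sup>2)) \<longlongrightarrow> 2 * l) at_top" by simp
  moreover have "filterlim (\<lambda>x::real. ln (1 + x\<^sup>2)) at_top at_top"
    by (intro filterlim_compose[OF ln_at_top] filterlim_tendsto_add_at_top[OF tendsto_const]
        filterlim_pow_at_top filterlim_ident) simp
  ultimately show False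
    using not_tendsto_and_filterlim_at_infinity[OF _ _ filterlim_at_top_imp_at_infinity]
    by (metis trivial_limit_at_top_linorder)
qed

theorem proposition8p4:
  shows "(\<forall>g G :: real \<Rightarrow> real.
            smooth g \<and> (\<forall>x. (G has_real_derivative g x) (at x)) \<longrightarrow>
            (\<exists>!\<phi>. circle_wave_map (\<lambda>x. 1) (\<lambda>x. \<i> * complex_of_real (g x)) \<phi>) \<and>
            (\<forall>\<phi>. circle_wave_map (\<lambda>x. 1) (\<lambda>x. \<i> * complex_of_real (g x)) \<phi> \<longrightarrow>
               (approaches_free_wave \<phi> \<longrightarrow>
                  (\<exists>Gp. (G \<longlongrightarrow> Gp) at_top) \<and> (\<exists>Gm. (G \<longlongrightarrow> Gm) at_bot)) \<and>
               (energy_data (\<lambda>x. 1) (\<lambda>x. \<i> * complex_of_real (g x)) \<longrightarrow>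
                  (approaches_free_wave \<phi> \<longleftrightarrow>
                     (\<exists>Gp. (G \<longlongrightarrow> Gp) at_top) \<and> (\<exists>Gm. (G \<longlongrightarrow> Gm) at_bot))))) \<and>
         (\<exists>g :: real \<Rightarrow> real. smooth g \<and>
            energy_data (\<lambda>x. 1) (\<lambda>x. \<i> * complex_of_real (g x)) \<and>
            (\<exists>\<phi>. circle_wave_map (\<lambda>x. 1) (\<lambda>x. \<i> * complex_of_real (g x)) \<phi>) \<and>
            (\<forall>\<phi>. circle_wave_map (\<lambda>x. 1) (\<lambda>x. \<i> * complex_of_real (g x)) \<phi> \<longrightarrow>
               \<not> approaches_free_wave \<phi>))"
proof -
  have cont: "continuous_on UNIV g" if "smooth g" for g
    using smooth_derivs(1)[OF that] by (auto intro: continuous_at_imp_continuous_on DERIV_isCont)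
  \<comment> \<open>The solution set is a single explicit function, for any choice of the primitive,
    so claims about all solutions become claims about the phase wave.\<close>
  have sol: "circle_wave_map (\<lambda>x. 1) (\<lambda>x. \<i> * complex_of_real (g x)) \<phi> \<longleftrightarrow> \<phi> = phase_wave G"
    if "smooth g" and G: "\<And>x. (G has_real_derivative g x) (at x)" for g G \<phi>
    using phase_wave_circle_wave_map[OF G smooth_derivs[OF that(1)]] circle_wave_map_unique[OF _ G] by blast
  \<comment> \<open>This velocity decays like \<open>1 / x\<close>: its square is integrable, while
    its primitive grows logarithmically.\<close>
  let ?g = "\<lambda>x::real. x / (1 + x\<^sup>2)" and ?G = "\<lambda>x::real. ln (1 + x\<^sup>2) / 2"
  have sm: "smooth ?g" using smooth_rational[of "[:0, 1:]" 1] by simp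
  have "\<not> approaches_free_wave (phase_wave ?G)"
    using phase_wave_scatters_imp_limits[OF slow_log_deriv cont[OF sm]] slow_log_no_limit by blast
  then have "\<exists>g :: real \<Rightarrow> real. smooth g \<and>
            energy_data (\<lambda>x. 1) (\<lambda>x. \<i> * complex_of_real (g x)) \<and>
            (\<exists>\<phi>. circle_wave_map (\<lambda>x. 1) (\<lambda>x. \<i> * complex_of_real (g x)) \<phi>) \<and>
            (\<forall>\<phi>. circle_wave_map (\<lambda>x. 1) (\<lambda>x. \<i> * complex_of_real (g x)) \<phi> \<longrightarrow>
               \<not> approaches_free_wave \<phi>)"
    using sm energy_data_slow_log sol[OF sm slow_log_deriv] by (intro exI[of _ ?g] conjI) auto
  moreover have "(\<exists>!\<phi>. circle_wave_map (\<lambda>x. 1) (\<lambda>x. \<i> * complex_of_real (g x)) \<phi>) \<and>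
            (\<forall>\<phi>. circle_wave_map (\<lambda>x. 1) (\<lambda>x. \<i> * complex_of_real (g x)) \<phi> \<longrightarrow>
               (approaches_free_wave \<phi> \<longrightarrow>
                  (\<exists>Gp. (G \<longlongrightarrow> Gp) at_top) \<and> (\<exists>Gm. (G \<longlongrightarrow> Gm) at_bot)) \<and>
               (energy_data (\<lambda>x. 1) (\<lambda>x. \<i> * complex_of_real (g x)) \<longrightarrow>
                  (approaches_free_wave \<phi> \<longleftrightarrow>
                     (\<exists>Gp. (G \<longlongrightarrow> Gp) at_top) \<and> (\<exists>Gm. (G \<longlongrightarrow> Gm) at_bot))))"
    if "smooth g \<and> (\<forall>x. (G has_real_derivative g x) (at x))" for g G
  proof -
    from that have s: "smooth g" and G: "\<And>x. (G has_real_derivative g x) (at x)" by auto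
    \<comment> \<open>The velocity part of \<open>energy_data\<close> is the square integrability
      used in the converse direction.\<close>
    show ?thesis
      unfolding sol[OF s G]
      using phase_wave_scatters_imp_limits[OF G cont[OF s]] phase_wave_limits_imp_scatters[OF G cont[OF s]]
      unfolding energy_data_def by blast
  qed
  ultimately show ?thesis by blast
qed

end
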